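(* Let $0<\varepsilon<1$ and $B>0$, and let $\beta>0$ (possibly depending on $n$). Let $\xi$ be a real random variable with $\mathbb{E}\xi=0$, $\mathbb{E}\xi^2=1$ such that $\mathbb{P}(c_1\le|\xi-\xi'|\le c_2)\ge c_3$ for positive constants $c_1<c_2$, $c_3$, where $\xi'$ is an independent copy of $\xi$. Let $A=(a_{ij})_{i,j=1}^n$ be a real matrix with $\sum_{i,j}a_{ij}^2=1$, let $f_1,\dots,f_n$ be fixed reals, $\mathbf{f}=(f_1,\dots,f_n)$, and let $\mathbf{x}=(x_1,\dots,x_n)$, $\mathbf{y}=(y_1,\dots,y_n)$ have all $x_i,y_j$ iid copies of $\xi$. Suppose $$\rho:=\sup_a\mathbb{P}_{\mathbf{x},\mathbf{y}}\Big(\Big|\sum_{i,j\le n}a_{ij}(x_i+f_i)(y_j+f_j)-a\Big|\le\beta\Big)\ge n^{-B}.$$ Then there exist a set $I_0\subset[n]$ of size $O_{B,\varepsilon}(1)$, a set $I\subset[n]$ of size at least $n-2n^{\varepsilon}$, and integers $k\neq0$ and $k_{ii_0}$ ($i\in I$, $i_0\in I_0$), all bounded in absolute value by $n^{O_{B,\varepsilon}(1)}$, such that the following holds. Let $R$ be the $n\times n$ matrix whose $i$-th row, for $i\in I$, is given by $(R)_{ij}=k_{ij}$ if $j\in I_0$, $(R)_{ii}=k$, and $(R)_{ij}=0$ otherwise; and whose rows $i\notin I$ have $(R)_{ii}=1$ and all other entries $0$. Then, with $A'=RA$, for every $i\in I$, $$\mathbb{P}_{\mathbf{y}}\big(|\langle\mathbf{y}+\mathbf{f},\mathrm{row}_i(A')\rangle|\le\beta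 n^{O_{B,\varepsilon}(1)}\big)\ge n^{-O_{B,\varepsilon}(1)}.$$
   Context: $\mathrm{row}_i(M)$ denotes the $i$-th row of a matrix $M$; $[n]=\{1,\dots,n\}$. The notation $O_{B,\varepsilon}(1)$ denotes a quantity bounded by a constant depending only on $B,\varepsilon$ (and on $c_1,c_2,c_3$), with asymptotics as $n\to\infty$. *)

theory Defs
  imports "HOL-Probability.Probability" "Jordan_Normal_Form.Matrix"
begin

text \<open>
  A real random variable \<open>\<xi>\<close> enters only through its law \<open>\<mu>\<close>, a Borel probability measure on the
  reals; independent copies of \<open>\<xi>\<close> are realised as the coordinates of product measures.  Indices run
  over \<open>{..<n}\<close> instead of \<open>{1..n}\<close>.
\<close>

text \<open>
  The Bochner integral of a non-integrable function is 0, so the second-moment equation below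
  already forces square integrability (hence integrability) of \<open>\<xi>\<close>.
\<close>

definition admissible_law :: "real \<Rightarrow> real \<Rightarrow> real \<Rightarrow> real measure \<Rightarrow> bool" where
  "admissible_law c1 c2 c3 \<mu> \<longleftrightarrow>
     prob_space \<mu> \<and> sets \<mu> = sets borel \<and>
     (\<integral>t. t \<partial>\<mu>) = 0 \<and> (\<integral>t. t\<^sup>2 \<partial>\<mu>) = 1 \<and>
     \<P>((s, t) in \<mu> \<Otimes>\<^sub>M \<mu>. c1 \<le> \<bar>s - t\<bar> \<and> \<bar>s - t\<bar> \<le> c2) \<ge> c3"

definition iid_vector :: "real measure \<Rightarrow> nat \<Rightarrow> (nat \<Rightarrow> real) measure" where
  "iid_vector \<mu> n = PiM {..<n} (\<lambda>_. \<mu>)"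

definition bilinear_concentration ::
    "real measure \<Rightarrow> nat \<Rightarrow> real mat \<Rightarrow> (nat \<Rightarrow> real) \<Rightarrow> real \<Rightarrow> real" where
  "bilinear_concentration \<mu> n A f \<beta> =
     (SUP a::real. \<P>((x, y) in iid_vector \<mu> n \<Otimes>\<^sub>M iid_vector \<mu> n.
        \<bar>(\<Sum>i<n. \<Sum>j<n. A $$ (i, j) * (x i + f i) * (y j + f j)) - a\<bar> \<le> \<beta>))"

text \<open>
  For \<open>i \<in> I \<inter> I0\<close> the diagonal entry is \<open>k\<close>, i.e. the coefficient \<open>K i i\<close> is read as \<open>k\<close>.
\<close>

definition row_operation ::
    "nat \<Rightarrow> nat set \<Rightarrow> nat set \<Rightarrow> int \<Rightarrow> (nat \<Rightarrow> nat \<Rightarrow> int) \<Rightarrow> real mat" where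
  "row_operation n I0 I k K = Matrix.mat n n (\<lambda>(i, j).
     if i \<in> I then
       (if j = i then real_of_int k else if j \<in> I0 then real_of_int (K i j) else 0)
     else (if j = i then 1 else 0))"

end

theory Submission imports Defs "HOL-Real_Asymp.Real_Asymp" begin

text \<open>
  For fixed \<open>y\<close> the bilinear form is a linear form in \<open>x\<close> with coefficients
  \<open>b i = \<langle>row i, y + f\<rangle>\<close>, so everything rests on an inverse theorem for linear forms
  \<open>\<Sum>i. b i * x i\<close> that concentrate with probability at least \<open>n powr (- B)\<close>.

  Gaussian smoothing bounds the concentration by an average of \<open>\<Prod>i. \<psi> i\<close>, where
  \<open>\<psi> i \<ge> 0\<close> is the characteristic function of one step of a lazy walk along \<open>b i\<close>.  By the
  inequality between arithmetic and geometric means, any \<open>L = n powr (\<epsilon> / 2)\<close> of the factors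
  can be replaced by \<open>L\<close> copies of one of them.  Hence among any \<open>L\<close> unused indices there is one
  along which a lazy walk with \<open>L\<close> steps may be run without lowering the bound.

  This is used twice.  First, if \<open>L\<close> unused indices are always independent, over integer
  coefficients of size \<open>n powr O(1)\<close>, of the ones chosen before, then each choice gains a factor
  \<open>n powr - c\<close>; so after boundedly many choices almost all \<open>b i\<close> are rational combinations of the
  chosen ones, with polynomially bounded heights.  Second, choosing indices whose rational
  coordinates do not lie in \<open>(1 / D) \<int>\<close> for the current common denominator \<open>D\<close> confines the walk
  to residue classes, so the total growth of \<open>D\<close> is polynomial.

  The dependence of the relations on \<open>y\<close> is removed by the pigeonhole principle, there being only
  polynomially many choices of \<open>I0\<close>, \<open>D\<close> and the coefficients in each row.
\<close>

subsection \<open>Lazy random walk on the integers\<close>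

text \<open>The law after \<open>L\<close> steps of the walk on the integers that moves by 1 in
  either direction with probability \<open>l / 2\<close> each and otherwise stays put.\<close>

primrec lazy_walk :: "real \<Rightarrow> nat \<Rightarrow> int \<Rightarrow> real" where
  "lazy_walk l 0 m = (if m = 0 then 1 else 0)"
| "lazy_walk l (Suc L) m =
     (1 - l) * lazy_walk l L m + l / 2 * (lazy_walk l L (m - 1) + lazy_walk l L (m + 1))"

lemma lazy_walk_nonneg: "0 \<le> l \<Longrightarrow> l \<le> 1 \<Longrightarrow> 0 \<le> lazy_walk l L m"
  by (induction L arbitrary: m) auto

lemma lazy_walk_eq_0: "\<bar>m\<bar> > int L \<Longrightarrow> lazy_walk l L m = 0"
  by (induction L arbitrary: m) auto

lemma lazy_walk_minus: "lazy_walk l L (- m) = lazy_walk l L m"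
proof (induction L arbitrary: m)
  case (Suc L)
  have "lazy_walk l L (- m - 1) = lazy_walk l L (m + 1)" "lazy_walk l L (- m + 1) = lazy_walk l L (m - 1)"
    using Suc[of "m + 1"] Suc[of "m - 1"] by (simp_all add: minus_add_distrib)
  then show ?case using Suc[of m] by simp
qed simp

text \<open>One step has characteristic function \<open>1 - l + l * cos t\<close>, and independent
  steps multiply. Any window containing the support may be used, so the induction keeps
  \<open>M\<close> while \<open>L\<close> grows.\<close>

lemma lazy_walk_cis:
  assumes "M \<ge> int L"
  shows "(\<Sum>m\<in>{-M..M}. of_real (lazy_walk l L m) * cis (of_int m * t))
           = of_real ((1 - l + l * cos t) ^ L)"
  using assms
proof (induction L arbitrary: M)
  case 0
  have "(\<Sum>m\<in>{-M..M}. complex_of_real (lazy_walk l 0 m) * cis (of_int m * t))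
      = (\<Sum>m\<in>{-M..M}. if m = 0 then 1 else 0)"
    by (intro sum.cong) auto
  then show ?case using 0 by simp
next
  case (Suc L)
  let ?g = "\<lambda>m::int. complex_of_real (lazy_walk l L m)"
  let ?e = "\<lambda>m::int. cis (of_int m * t)"
  let ?S = "\<Sum>m\<in>{-M..M}. ?g m * ?e m"
  have S: "?S = of_real ((1 - l + l * cos t) ^ L)" using Suc by simp

  have sub: "(\<Sum>m\<in>{-M..M}. ?g (m - 1) * ?e m) = cis t * ?S"
  proof -
    have "(\<Sum>m\<in>{-M..M}. ?g (m - 1) * ?e m) = (\<Sum>m\<in>{-M-1..M-1}. ?g m * ?e (m + 1))"
      by (rule sum.reindex_bij_witness[of _ "\<lambda>m. m + 1" "\<lambda>m. m - 1"]) auto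
    \<comment> \<open>Moving the window by one place changes only end terms, which vanish because
      \<open>M >= Suc L\<close> exceeds the range of \<open>L\<close> steps.\<close>
    also have "\<dots> = (\<Sum>m\<in>{-M-1..M}. ?g m * ?e (m + 1))"
      using Suc.prems by (intro sum.mono_neutral_left) (auto intro!: lazy_walk_eq_0)
    also have "\<dots> = (\<Sum>m\<in>{-M..M}. ?g m * ?e (m + 1))"
      using Suc.prems by (intro sum.mono_neutral_right) (auto intro!: lazy_walk_eq_0)
    also have "\<dots> = cis t * ?S"
      unfolding sum_distrib_left
      by (intro sum.cong refl) (simp add: distrib_right flip: cis_mult)
    finally show ?thesis .
  qed
  have add: "(\<Sum>m\<in>{-M..M}. ?g (m + 1) * ?e m) = cis (- t) * ?S"
  proof -
    have "(\<Sum>m\<in>{-M..M}. ?g (m + 1) * ?e m) = (\<Sum>m\<in>{-M+1..M+1}. ?g m * ?e (m - 1))"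
      by (rule sum.reindex_bij_witness[of _ "\<lambda>m. m - 1" "\<lambda>m. m + 1"]) auto
    also have "\<dots> = (\<Sum>m\<in>{-M..M+1}. ?g m * ?e (m - 1))"
      using Suc.prems by (intro sum.mono_neutral_left) (auto intro!: lazy_walk_eq_0)
    also have "\<dots> = (\<Sum>m\<in>{-M..M}. ?g m * ?e (m - 1))"
      using Suc.prems by (intro sum.mono_neutral_right) (auto intro!: lazy_walk_eq_0)
    also have "\<dots> = cis (- t) * ?S"
    proof -
      have "?e (m - 1) = cis (- t) * ?e m" for m by (simp add: cis_mult algebra_simps)
      then show ?thesis by (simp add: sum_distrib_left mult_ac)
    qed
    finally show ?thesis .
  qed
  have "(\<Sum>m\<in>{-M..M}. of_real (lazy_walk l (Suc L) m) * ?e m)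
      = (\<Sum>m\<in>{-M..M}. of_real (1 - l) * (?g m * ?e m) + of_real (l / 2) * (?g (m - 1) * ?e m)
            + of_real (l / 2) * (?g (m + 1) * ?e m))"
    by (intro sum.cong) (simp_all add: algebra_simps)
  also have "\<dots> = of_real (1 - l) * ?S + of_real (l / 2) * (cis t * ?S) + of_real (l / 2) * (cis (- t) * ?S)"
    unfolding sum.distrib sum_distrib_left[symmetric] sub add by simp
  also have "\<dots> = (of_real (1 - l) + of_real (l / 2) * (cis t + cis (- t))) * ?S"
    by (simp only: distrib_left distrib_right mult.assoc add.assoc)
  also have "cis t + cis (- t) = of_real (2 * cos t)" by (simp add: complex_eq_iff)
  also have "of_real (1 - l) + complex_of_real (l / 2) * of_real (2 * cos t) = of_real (1 - l + l * cos t)"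
    by (simp only: of_real_mult[symmetric] of_real_add[symmetric]) simp
  finally show ?case unfolding S by (simp only: of_real_mult[symmetric] power_Suc)
qed

lemma lazy_walk_sum: "M \<ge> int L \<Longrightarrow> (\<Sum>m\<in>{-M..M}. lazy_walk l L m) = 1"
proof -
  assume "M \<ge> int L"
  then have "(\<Sum>m\<in>{-M..M}. complex_of_real (lazy_walk l L m)) = 1"
    using lazy_walk_cis[of L M l 0] by simp
  then have "complex_of_real (\<Sum>m\<in>{-M..M}. lazy_walk l L m) = of_real 1" by simp
  then show ?thesis using of_real_eq_iff by blast
qed

text \<open>Unimodality comes from laziness: a walk that always moves alternates between parities.
  At the origin the reflection symmetry leaves the coefficient \<open>1 - l - l/2\<close>,
  nonnegative for \<open>l <= 1/2\<close>.\<close>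

lemma lazy_walk_decreasing:
  assumes "0 \<le> l" "l \<le> 1/2" "0 \<le> m"
  shows "lazy_walk l L (m + 1) \<le> lazy_walk l L m"
  using assms(3)
proof (induction L arbitrary: m)
  case 0
  then show ?case by auto
next
  case (Suc L)
  let ?p = "lazy_walk l L"
  have a: "?p (m + 1) \<le> ?p m" "?p (m + 1 + 1) \<le> ?p (m + 1)"
    using Suc.IH[of m] Suc.IH[of "m + 1"] Suc.prems by simp_all
  show ?case
  proof (cases "m = 0")
    case True
    have "?p (-1) = ?p 1" using lazy_walk_minus[of l L 1] by simp
    moreover have "?p 1 \<le> ?p 0" "?p 2 \<le> ?p 1" using a True by simp_all
    then have "(1 - l - l/2) * (?p 0 - ?p 1) + l/2 * (?p 1 - ?p 2) \<ge> 0"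
      using assms by (intro add_nonneg_nonneg mult_nonneg_nonneg) auto
    ultimately show ?thesis using True by (simp add: field_simps)
  next
    case False
    then have "?p (m - 1 + 1) \<le> ?p (m - 1)" using Suc by (intro Suc.IH) auto
    then have "(1 - l) * (?p m - ?p (m+1)) + l/2 * (?p (m - 1) - ?p m) + l/2 * (?p (m+1) - ?p (m+1+1)) \<ge> 0"
      using assms a by (intro add_nonneg_nonneg mult_nonneg_nonneg) auto
    then show ?thesis by (simp add: algebra_simps)
  qed
qed

lemma lazy_walk_mono:
  assumes "0 \<le> l" "l \<le> 1/2" "0 \<le> m" "m \<le> m'"
  shows "lazy_walk l L m' \<le> lazy_walk l L m"
  using assms(4)
proof (induction m' rule: int_ge_induct)
  case (step i)
  then show ?case using lazy_walk_decreasing[of l i L] assms by linarith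
qed simp

lemma lazy_walk_le_0:
  assumes "0 \<le> l" "l \<le> 1/2"
  shows "lazy_walk l L m \<le> lazy_walk l L 0"
proof (cases "m \<ge> 0")
  case False
  then show ?thesis using lazy_walk_mono[of l 0 "-m" L] assms lazy_walk_minus[of l L m] by simp
qed (use lazy_walk_mono[of l 0 m L] assms in simp)

text \<open>Monotonicity allows each value beyond the first period to be averaged over the preceding
  \<open>d\<close> values, and the averaging blocks are disjoint.\<close>

lemma lazy_walk_residue_pos:
  assumes l: "0 \<le> l" "l \<le> 1/2" and d: "d > 0"
    and R: "R \<subseteq> {0..int L}" "\<And>m m'. m \<in> R \<Longrightarrow> m' \<in> R \<Longrightarrow> int d dvd m - m'"
  shows "(\<Sum>m\<in>R. lazy_walk l L m) \<le> (\<Sum>m\<in>{1..int L}. lazy_walk l L m) / d + lazy_walk l L 0"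
proof -
  let ?p = "lazy_walk l L"
  define R0 where "R0 = {m\<in>R. m < int d}"
  define R1 where "R1 = {m\<in>R. m \<ge> int d}"
  have fin: "finite R" using R(1) finite_subset by blast
  have split: "(\<Sum>m\<in>R. ?p m) = (\<Sum>m\<in>R0. ?p m) + (\<Sum>m\<in>R1. ?p m)"
    unfolding R0_def R1_def using fin
    by (subst sum.union_disjoint[symmetric]) (auto intro!: sum.cong)
  \<comment> \<open>At most one member of the class lies below \<open>d\<close>, and it costs at
    most the central value.\<close>
  have "m = m'" if "m \<in> R0" "m' \<in> R0" for m m'
  proof -
    have "int d dvd m - m'" "0 \<le> m" "0 \<le> m'" "m < int d" "m' < int d"
      using that R unfolding R0_def by auto
    then have "int d dvd m - m'" "\<bar>m - m'\<bar> < int d" by linarith+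
    then show ?thesis using zdvd_not_zless[of "\<bar>m - m'\<bar>" "int d"] by force
  qed
  then have "R0 = {} \<or> (\<exists>m. R0 = {m})" by blast
  then have 0: "(\<Sum>m\<in>R0. ?p m) \<le> ?p 0"
    using lazy_walk_le_0[OF l] lazy_walk_nonneg[of l] l by auto
  have inj: "inj_on (\<lambda>(m, s). m - int s) (R1 \<times> {..<d})"
  proof (rule inj_onI, clarsimp)
    fix m s m' s' assume h: "m \<in> R1" "m' \<in> R1" "s < d" "s' < d" "m - int s = m' - int s'"
    then have "int d dvd m - m'" using R unfolding R1_def by auto
    moreover have "m - m' = int s - int s'" using h by simp
    ultimately have "int d dvd int s - int s'" "\<bar>int s - int s'\<bar> < int d" using h by auto
    then have "s = s'" using zdvd_not_zless[of "\<bar>int s - int s'\<bar>" "int d"] by force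
    then show "m = m' \<and> s = s'" using h by simp
  qed
  have "d * (\<Sum>m\<in>R1. ?p m) = (\<Sum>m\<in>R1. \<Sum>s<d. ?p m)" by (simp add: sum_distrib_left)
  also have "\<dots> \<le> (\<Sum>m\<in>R1. \<Sum>s<d. ?p (m - int s))"
    unfolding R1_def by (intro sum_mono lazy_walk_mono l) auto
  also have "\<dots> = (\<Sum>m\<in>(\<lambda>(m, s). m - int s) ` (R1 \<times> {..<d}). ?p m)"
    by (subst sum.reindex[OF inj]) (simp add: sum.cartesian_product case_prod_unfold)
  \<comment> \<open>The lowest entry of a block is \<open>m - d + 1 >= 1\<close>, so the origin
    stays out; this lets the two half-lines later share a total mass of 1.\<close>
  also have "\<dots> \<le> (\<Sum>m\<in>{1..int L}. ?p m)"
    using R(1) unfolding R1_def by (intro sum_mono2) (auto intro!: lazy_walk_nonneg l order_trans[OF l(2)])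
  finally have "(\<Sum>m\<in>R1. ?p m) \<le> (\<Sum>m\<in>{1..int L}. ?p m) / d"
    using d by (simp add: field_simps)
  then show ?thesis using split 0 by simp
qed

text \<open>The one-sided bound is applied to the nonnegative part and to the reflection of the
  negative part. The two half-line masses add up to at most 1, and each side costs one central
  value.\<close>

lemma lazy_walk_residue:
  assumes l: "0 \<le> l" "l \<le> 1/2" and d: "d > 0"
    and R: "R \<subseteq> {-int L..int L}" "\<And>m m'. m \<in> R \<Longrightarrow> m' \<in> R \<Longrightarrow> int d dvd m - m'"
  shows "(\<Sum>m\<in>R. lazy_walk l L m) \<le> 1 / d + 2 * lazy_walk l L 0"
proof -
  let ?p = "lazy_walk l L"
  have fin: "finite R" using R(1) finite_subset by blast
  define Rp where "Rp = {m\<in>R. m \<ge> 0}"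
  define Rn where "Rn = {m\<in>R. m < 0}"
  have split: "(\<Sum>m\<in>R. ?p m) = (\<Sum>m\<in>Rp. ?p m) + (\<Sum>m\<in>Rn. ?p m)"
    unfolding Rp_def Rn_def using fin
    by (subst sum.union_disjoint[symmetric]) (auto intro!: sum.cong)
  have 1: "(\<Sum>m\<in>Rp. ?p m) \<le> (\<Sum>m\<in>{1..int L}. ?p m) / d + ?p 0"
    using R unfolding Rp_def by (intro lazy_walk_residue_pos l d) auto
  have "(\<Sum>m\<in>Rn. ?p m) = (\<Sum>m\<in>uminus ` Rn. ?p m)"
    by (subst sum.reindex) (auto simp: lazy_walk_minus inj_on_def)
  also have "\<dots> \<le> (\<Sum>m\<in>{1..int L}. ?p m) / d + ?p 0"
  proof (intro lazy_walk_residue_pos l d)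
    show "uminus ` Rn \<subseteq> {0..int L}" using R(1) unfolding Rn_def by auto
    fix m m' assume "m \<in> uminus ` Rn" "m' \<in> uminus ` Rn"
    then have "int d dvd (- m') - (- m)" using R(2)[of "-m'" "-m"] unfolding Rn_def by auto
    then show "int d dvd m - m'" by simp
  qed
  finally have 2: "(\<Sum>m\<in>Rn. ?p m) \<le> (\<Sum>m\<in>{1..int L}. ?p m) / d + ?p 0" .
  have "(\<Sum>m\<in>{1..int L}. ?p m) + (\<Sum>m\<in>{1..int L}. ?p m)
      = (\<Sum>m\<in>{1..int L}. ?p m) + (\<Sum>m\<in>{-int L..-1}. ?p m)"
    by (intro arg_cong2[where f="(+)"] refl sum.reindex_bij_witness[of _ uminus uminus])
       (auto simp: lazy_walk_minus)
  also have "\<dots> \<le> (\<Sum>m\<in>{-int L..int L}. ?p m)"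
    by (subst sum.union_disjoint[symmetric]) 
       (auto intro!: sum_mono2 lazy_walk_nonneg l order_trans[OF l(2)])
  also have "\<dots> = 1" by (rule lazy_walk_sum) simp
  finally have "((\<Sum>m\<in>{1..int L}. ?p m) + (\<Sum>m\<in>{1..int L}. ?p m)) / d \<le> 1 / d"
    by (intro divide_right_mono) auto
  then show ?thesis using split 1 2 by (simp add: add_divide_distrib)
qed

section \<open>Return probability of the lazy walk\<close>

lemma one_minus_cos_ge:
  assumes "\<bar>t\<bar> \<le> pi"
  shows "1 - cos t \<ge> t\<^sup>2 / 18"
proof -
  \<comment> \<open>Half the angle stays in \<open>[0, 2]\<close>, where the cubic Taylor bound
    gives \<open>sin x >= x / 3\<close>; then \<open>1 - cos t = 2 * (sin x)^2\<close> produces the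
    constant 18.\<close>
  define x where "x = \<bar>t\<bar> / 2"
  have x: "0 \<le> x" "x \<le> 2" using assms pi_less_4 by (auto simp: x_def)
  have "\<bar>sin x - (\<Sum>m<3. sin_coeff m * x ^ m)\<bar> \<le> inverse (fact 3) * \<bar>x\<bar> ^ 3"
    by (rule Maclaurin_sin_bound)
  then have "sin x \<ge> x - x ^ 3 / 6"
    using x unfolding abs_le_iff by (simp add: sin_coeff_def eval_nat_numeral)
  moreover have "x * x\<^sup>2 \<le> x * 2\<^sup>2" using x by (intro mult_left_mono power_mono) auto
  then have "x ^ 3 \<le> 4 * x" by (simp add: power3_eq_cube power2_eq_square)
  ultimately have "sin x \<ge> x / 3" by simp
  then have "(sin x)\<^sup>2 \<ge> (x / 3)\<^sup>2" using x by (intro power_mono) auto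
  moreover have "cos t = 1 - 2 * (sin x)\<^sup>2"
    using cos_double_sin[of x] by (simp add: x_def)
  ultimately show ?thesis by (simp add: x_def power_divide power2_eq_square)
qed

lemma integral_cos_int_period:
  "((\<lambda>t. cos (of_int m * t)) has_integral (if m = 0 then 2 * pi else 0)) {-pi..pi}"
proof (cases "m = 0")
  case False
  have "((\<lambda>t. cos (of_int m * t)) has_integral
          (sin (of_int m * pi) / of_int m - sin (of_int m * (- pi)) / of_int m)) {-pi..pi}"
    using False
    by (intro fundamental_theorem_of_calculus)
       (auto intro!: derivative_eq_intros simp flip: has_real_derivative_iff_has_vector_derivative)
  moreover have "sin (of_int m * pi) = 0" by (metis sin_int_times_real mult.commute sin_npi_int)
  ultimately show ?thesis using False by simp
qed (use has_integral_const_real[of "1::real" "-pi" pi] in simp)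

text \<open>Fourier inversion at the origin: \<open>2 * pi\<close> times the return probability is
  the integral of the characteristic function over a period. That function is dominated by
  \<open>exp (- a * t^2) <= 1 / (1 + a * t^2)\<close>, whose primitive is an arctangent.\<close>

lemma lazy_walk_0_le:
  assumes l: "0 < l" "l \<le> 1/2" and L: "L > 0"
  shows "lazy_walk l L 0 \<le> 3 / sqrt (l * L)"
proof -
  define a where "a = l * L / 18"
  have a: "a > 0" using l L by (simp add: a_def)
  have re: "(1 - l + l * cos t) ^ L = (\<Sum>m\<in>{-int L..int L}. lazy_walk l L m * cos (of_int m * t))" for t
    using arg_cong[OF lazy_walk_cis[of L "int L" l t], of Re] by simp
  have "((\<lambda>t. \<Sum>m\<in>{-int L..int L}. lazy_walk l L m * cos (of_int m * t)) has_integral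
      (\<Sum>m\<in>{-int L..int L}. lazy_walk l L m * (if m = 0 then 2 * pi else 0))) {-pi..pi}"
    by (intro has_integral_sum has_integral_mult_right integral_cos_int_period) simp
  also have "(\<Sum>m\<in>{-int L..int L}. lazy_walk l L m * (if m = 0 then 2 * pi else 0))
       = (\<Sum>m\<in>{-int L..int L}. if m = 0 then lazy_walk l L 0 * (2 * pi) else 0)"
    by (intro sum.cong) auto
  also have "\<dots> = lazy_walk l L 0 * (2 * pi)" by simp
  finally have I1: "((\<lambda>t. (1 - l + l * cos t) ^ L) has_integral lazy_walk l L 0 * (2 * pi)) {-pi..pi}"
    by (simp only: re)
  have I2: "((\<lambda>t. 1 / (1 + a * t\<^sup>2)) has_integral
        (arctan (sqrt a * pi) / sqrt a - arctan (sqrt a * (- pi)) / sqrt a)) {-pi..pi}"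
    using a
    by (intro fundamental_theorem_of_calculus)
       (auto intro!: derivative_eq_intros simp: power_mult_distrib inverse_eq_divide
          simp flip: has_real_derivative_iff_has_vector_derivative)
  have "(1 - l + l * cos t) ^ L \<le> 1 / (1 + a * t\<^sup>2)" if "t \<in> {-pi..pi}" for t
  proof -
    have c: "t\<^sup>2 / 18 \<le> 1 - cos t" using that by (intro one_minus_cos_ge) auto
    have nn: "0 \<le> 1 - l + l * cos t"
      using l mult_left_mono[OF cos_ge_minus_one[of t], of l] by simp
    have "1 - l + l * cos t \<le> exp (- (l * (1 - cos t)))"
      using exp_ge_add_one_self[of "- (l * (1 - cos t))"] by (simp add: algebra_simps)
    then have "(1 - l + l * cos t) ^ L \<le> exp (- (l * (1 - cos t))) ^ L"
      using nn by (intro power_mono) auto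
    also have "\<dots> = exp (- (L * (l * (1 - cos t))))" by (simp add: exp_of_nat_mult[symmetric])
    also have "\<dots> \<le> exp (- (a * t\<^sup>2))"
      using mult_left_mono[OF c, of "l * L"] l by (simp add: a_def algebra_simps)
    also have "\<dots> \<le> 1 / (1 + a * t\<^sup>2)"
      using exp_ge_add_one_self[of "a * t\<^sup>2"] a
      by (simp add: exp_minus field_simps pos_divide_le_eq add_pos_nonneg)
    finally show ?thesis .
  qed
  then have "lazy_walk l L 0 * (2 * pi) \<le> arctan (sqrt a * pi) / sqrt a - arctan (sqrt a * (- pi)) / sqrt a"
    using has_integral_le[OF I1 I2] by auto
  also have "\<dots> = 2 * arctan (sqrt a * pi) / sqrt a" by (simp add: arctan_minus)
  also have "\<dots> \<le> 2 * (pi / 2) / sqrt a"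
    using arctan_ubound[of "sqrt a * pi"] a by (intro divide_right_mono) auto
  finally have "pi * lazy_walk l L 0 \<le> pi * (1 / (2 * sqrt a))" by (simp add: field_simps)
  then have "lazy_walk l L 0 \<le> 1 / (2 * sqrt a)" using pi_gt_zero mult_le_cancel_left_pos by blast
  also have "sqrt a = sqrt (l * L) / sqrt 18" by (simp add: a_def real_sqrt_divide)
  also have "1 / (2 * (sqrt (l * L) / sqrt 18)) = sqrt 18 / 2 / sqrt (l * L)" by simp
  also have "\<dots> \<le> 3 / sqrt (l * L)"
    using l by (intro divide_right_mono) (auto intro!: real_le_lsqrt)
  finally show ?thesis .
qed

subsection \<open>Concentration and characteristic functions\<close>

interpretation std_normal: real_distribution std_normal_distribution
  by (rule real_dist_normal_dist)

lemma integral_std_normal_iexp: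
  "(CLINT g|std_normal_distribution. iexp (s * g)) = complex_of_real (exp (- s\<^sup>2 / 2))"
  using fun_cong[OF char_std_normal_distribution, of s] by (simp add: char_def)

text \<open>For a Gaussian frequency \<open>g\<close>, the product of characteristic functions
  averages to the expected value of \<open>exp (- s^2 / 2)\<close>, where \<open>s\<close> is the
  endpoint of independent walks of \<open>L\<close> steps along the numbers
  \<open>t j\<close>.\<close>

lemma std_normal_integral_walk_prod:
  fixes t :: "'i \<Rightarrow> real"
  assumes "finite U"
  shows "(LINT g|std_normal_distribution. (\<Prod>j\<in>U. (1 - l + l * cos (t j * g)) ^ L))
       = (\<Sum>m\<in>PiE U (\<lambda>_. {-int L..int L}).
            (\<Prod>j\<in>U. lazy_walk l L (m j)) * exp (- (\<Sum>j\<in>U. of_int (m j) * t j)\<^sup>2 / 2))"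
    (is "?I = ?S")
proof -
  let ?P = "PiE U (\<lambda>_. {-int L..int L})"
  have *: "complex_of_real (\<Prod>j\<in>U. (1 - l + l * cos (t j * g)) ^ L)
     = (\<Sum>m\<in>?P. of_real (\<Prod>j\<in>U. lazy_walk l L (m j)) * iexp ((\<Sum>j\<in>U. of_int (m j) * t j) * g))" for g
  proof -
    have "complex_of_real (\<Prod>j\<in>U. (1 - l + l * cos (t j * g)) ^ L)
        = (\<Prod>j\<in>U. \<Sum>m\<in>{-int L..int L}. of_real (lazy_walk l L m) * cis (of_int m * (t j * g)))"
      by (subst lazy_walk_cis) (auto simp: of_real_prod)
    also have "\<dots> = (\<Sum>m\<in>?P. \<Prod>j\<in>U. of_real (lazy_walk l L (m j)) * cis (of_int (m j) * (t j * g)))"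
      using assms by (intro prod_sum_PiE) auto
    also have "\<dots> = (\<Sum>m\<in>?P. of_real (\<Prod>j\<in>U. lazy_walk l L (m j)) * iexp ((\<Sum>j\<in>U. of_int (m j) * t j) * g))"
    proof (intro sum.cong refl)
      fix m
      have "(\<Prod>j\<in>U. cis (of_int (m j) * (t j * g))) = iexp ((\<Sum>j\<in>U. of_int (m j) * t j) * g)"
        using assms by (simp add: cis_conv_exp exp_sum sum_distrib_left sum_distrib_right mult_ac)
      then show "(\<Prod>j\<in>U. of_real (lazy_walk l L (m j)) * cis (of_int (m j) * (t j * g)))
          = of_real (\<Prod>j\<in>U. lazy_walk l L (m j)) * iexp ((\<Sum>j\<in>U. of_int (m j) * t j) * g)"
        by (simp add: prod.distrib)
    qed
    finally show ?thesis .
  qed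
  have "complex_of_real ?I = (CLINT g|std_normal_distribution. complex_of_real (\<Prod>j\<in>U. (1 - l + l * cos (t j * g)) ^ L))"
    by (rule integral_complex_of_real[symmetric])
  also have "\<dots> = (\<Sum>m\<in>?P. of_real (\<Prod>j\<in>U. lazy_walk l L (m j)) *
      (CLINT g|std_normal_distribution. iexp ((\<Sum>j\<in>U. of_int (m j) * t j) * g)))"
    unfolding * by (subst Bochner_Integration.integral_sum)
      (auto intro!: std_normal.integrable_iexp)
  also have "\<dots> = complex_of_real ?S"
    unfolding integral_std_normal_iexp by simp
  finally show ?thesis using of_real_eq_iff by blast
qed

text \<open>Smoothing with a Gaussian kernel instead of a compactly supported one makes the
  integrand an expectation, so that no Fourier inversion is needed.\<close>

lemma (in prob_space) concentration_le_char:
  assumes X [measurable]: "X \<in> borel_measurable M" and \<beta>: "\<beta> > 0"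
  shows "prob {x\<in>space M. \<bar>X x - a\<bar> \<le> \<beta>}
     \<le> exp (1/2) * (LINT g|std_normal_distribution. norm (char (distr M borel X) (g / \<beta>)))"
proof -
  let ?N = std_normal_distribution
  define Y where "Y = (\<lambda>x. (X x - a) / \<beta>)"
  have [measurable]: "Y \<in> borel_measurable M" unfolding Y_def by measurable
  interpret N: real_distribution ?N by (rule real_dist_normal_dist)
  interpret P: pair_prob_space M ?N ..
  interpret X: real_distribution "distr M borel X" using X by (rule real_distribution_distr)
  have "prob {x\<in>space M. \<bar>X x - a\<bar> \<le> \<beta>} = expectation (indicator {x\<in>space M. \<bar>X x - a\<bar> \<le> \<beta>})"
    by simp
  \<comment> \<open>On the event, \<open>Y x\<close> lies in \<open>[-1, 1]\<close> and the Gaussian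
    weight is at least \<open>exp (- 1/2)\<close>; this is the origin of the factor.\<close>
  also have "\<dots> \<le> expectation (\<lambda>x. exp (1/2) * exp (- (Y x)\<^sup>2 / 2))"
  proof (intro integral_mono)
    show "integrable M (\<lambda>x. exp (1/2) * exp (- (Y x)\<^sup>2 / 2))"
      by (intro integrable_mult_right integrable_const_bound[of _ 1]) auto
    fix x
    have "1 \<le> exp (1/2 + - (Y x)\<^sup>2 / 2)" if "\<bar>X x - a\<bar> \<le> \<beta>"
    proof -
      have "\<bar>Y x\<bar> \<le> 1" using that \<beta> by (simp add: Y_def)
      then have "(Y x)\<^sup>2 \<le> 1" by (simp add: abs_square_le_1)
      then show ?thesis by simp
    qed
    then show "indicator {x \<in> space M. \<bar>X x - a\<bar> \<le> \<beta>} x \<le> exp (1/2) * exp (- (Y x)\<^sup>2 / 2)"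
      by (auto simp: indicator_def exp_add[symmetric])
  qed (auto simp: integrable_indicator_iff less_top[symmetric])
  also have "\<dots> = exp (1/2) * expectation (\<lambda>x. exp (- (Y x)\<^sup>2 / 2))" by simp
  finally have 1: "prob {x\<in>space M. \<bar>X x - a\<bar> \<le> \<beta>} \<le> exp (1/2) * expectation (\<lambda>x. exp (- (Y x)\<^sup>2 / 2))" .
  have int: "integrable (M \<Otimes>\<^sub>M ?N) (\<lambda>(x, g). iexp (Y x * g))"
    by (intro P.P.integrable_const_bound[of _ 1]) auto
  have "complex_of_real (expectation (\<lambda>x. exp (- (Y x)\<^sup>2 / 2))) = (CLINT x|M. CLINT g|?N. iexp (Y x * g))"
    unfolding integral_std_normal_iexp by simp
  also have "\<dots> = (CLINT g|?N. CLINT x|M. iexp (Y x * g))"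
    using P.Fubini_integral[OF int] by simp
  \<comment> \<open>Centring at \<open>a\<close> contributes only a phase, so the final bound is
    uniform in \<open>a\<close>.\<close>
  also have "\<dots> = (CLINT g|?N. iexp (- (a / \<beta>) * g) * char (distr M borel X) (g / \<beta>))"
  proof (intro Bochner_Integration.integral_cong refl)
    fix g
    have "iexp (Y x * g) = iexp (- (a / \<beta>) * g) * iexp (g / \<beta> * X x)" for x
      by (simp add: Y_def exp_add[symmetric] algebra_simps diff_divide_distrib)
    then show "(CLINT x|M. iexp (Y x * g)) = iexp (- (a / \<beta>) * g) * char (distr M borel X) (g / \<beta>)"
      by (simp add: char_def integral_distr)
  qed
  finally have "expectation (\<lambda>x. exp (- (Y x)\<^sup>2 / 2))
     = Re (CLINT g|?N. iexp (- (a / \<beta>) * g) * char (distr M borel X) (g / \<beta>))"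
    by (metis Re_complex_of_real)
  also have "\<dots> \<le> norm (CLINT g|?N. iexp (- (a / \<beta>) * g) * char (distr M borel X) (g / \<beta>))"
    by (rule complex_Re_le_cmod)
  also have "\<dots> \<le> (LINT g|?N. norm (iexp (- (a / \<beta>) * g) * char (distr M borel X) (g / \<beta>)))"
    by (rule integral_norm_bound)
  also have "\<dots> = (LINT g|?N. norm (char (distr M borel X) (g / \<beta>)))"
    by (simp add: norm_mult)
  finally show ?thesis using 1 by (smt (verit) exp_gt_zero mult_left_mono)
qed

text \<open>Symmetrisation: multiplying by the conjugate gives the characteristic function of the
  difference of two independent copies, which is real.\<close>

lemma norm_char_squared:
  assumes "real_distribution \<mu>"
  shows "(norm (char \<mu> t))\<^sup>2 = (LINT p|(\<mu> \<Otimes>\<^sub>M \<mu>). cos (t * (fst p - snd p)))"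
proof -
  interpret real_distribution \<mu> by fact
  interpret P: pair_prob_space \<mu> \<mu> ..
  have [measurable_cong]: "sets \<mu> = sets borel" by simp
  have int: "integrable (\<mu> \<Otimes>\<^sub>M \<mu>) (\<lambda>(x, y). iexp (t * x) * iexp (- (t * y)))"
    by (intro P.P.integrable_const_bound[of _ 1]) (auto simp: norm_mult)
  have "complex_of_real ((norm (char \<mu> t))\<^sup>2) = char \<mu> t * cnj (char \<mu> t)"
    by (rule complex_norm_square)
  also have "cnj (char \<mu> t) = (CLINT y|\<mu>. iexp (- (t * y)))"
    proof -
    have "(CLINT y|\<mu>. iexp (- (t * y))) = (CLINT y|\<mu>. cnj (iexp (t * y)))" by (simp add: exp_cnj)
    then show ?thesis unfolding char_def integral_cnj by simp
  qed
  also have "char \<mu> t * (CLINT y|\<mu>. iexp (- (t * y))) = (CLINT x|\<mu>. CLINT y|\<mu>. iexp (t * x) * iexp (- (t * y)))"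
    by (simp add: char_def)
  also have "\<dots> = (CLINT p|(\<mu> \<Otimes>\<^sub>M \<mu>). iexp (t * (fst p - snd p)))"
    using P.integral_fst'[OF int] by (simp add: case_prod_unfold exp_add[symmetric] algebra_simps)
  finally have "(norm (char \<mu> t))\<^sup>2 = Re (CLINT p|(\<mu> \<Otimes>\<^sub>M \<mu>). iexp (t * (fst p - snd p)))"
    by (metis Re_complex_of_real)
  also have "\<dots> = (LINT p|(\<mu> \<Otimes>\<^sub>M \<mu>). Re (iexp (t * (fst p - snd p))))"
    by (intro integral_Re[symmetric] P.P.integrable_const_bound[of _ 1]) auto
  finally show ?thesis by (simp add: Re_exp)
qed

text \<open>As \<open>1 - cos\<close> is nonnegative, discarding the pairs outside
  \<open>\<Omega>\<close> only enlarges the bound for the squared norm; then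
  \<open>1 - x <= exp (- x)\<close>, and the square root halves the exponent.\<close>

lemma norm_char_le_exp:
  assumes "real_distribution \<mu>" and \<Omega>: "\<Omega> \<in> sets (\<mu> \<Otimes>\<^sub>M \<mu>)"
  shows "norm (char \<mu> t) \<le> exp (- (LINT p|(\<mu> \<Otimes>\<^sub>M \<mu>). indicator \<Omega> p * (1 - cos (t * (fst p - snd p)))) / 2)"
proof -
  interpret real_distribution \<mu> by fact
  interpret P: pair_prob_space \<mu> \<mu> ..
  have [measurable_cong]: "sets \<mu> = sets borel" by simp
  note \<Omega> [measurable]
  let ?x = "LINT p|(\<mu> \<Otimes>\<^sub>M \<mu>). indicator \<Omega> p * (1 - cos (t * (fst p - snd p)))"
  have int: "integrable (\<mu> \<Otimes>\<^sub>M \<mu>) (\<lambda>p. cos (t * (fst p - snd p)))"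
    by (intro P.P.integrable_const_bound[of _ 1]) auto
  have "?x \<le> (LINT p|(\<mu> \<Otimes>\<^sub>M \<mu>). 1 - cos (t * (fst p - snd p)))"
  proof (intro integral_mono)
    show "integrable (\<mu> \<Otimes>\<^sub>M \<mu>) (\<lambda>p. indicator \<Omega> p * (1 - cos (t * (fst p - snd p))))"
    proof (intro P.P.integrable_const_bound[of _ 2] AE_I2)
      fix p show "norm (indicator \<Omega> p * (1 - cos (t * (fst p - snd p)))) \<le> 2"
        using cos_ge_minus_one[of "t * (fst p - snd p)"] by (auto simp: indicator_def)
    qed measurable
  qed (use int in \<open>auto simp: indicator_def\<close>)
  also have "\<dots> = 1 - (norm (char \<mu> t))\<^sup>2"
    using int by (simp add: norm_char_squared[OF assms(1)] P.P.prob_space)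
  finally have "(norm (char \<mu> t))\<^sup>2 \<le> 1 + - ?x" by simp
  also have "\<dots> \<le> exp (- ?x)" by (rule exp_ge_add_one_self)
  also have "\<dots> = (exp (- ?x / 2))\<^sup>2" by (simp add: exp_double[symmetric])
  finally show ?thesis by (rule power2_le_imp_le) simp
qed

lemma char_linear_PiM:
  assumes "real_distribution \<mu>" "finite I"
  shows "char (distr (PiM I (\<lambda>_. \<mu>)) borel (\<lambda>x. \<Sum>i\<in>I. b i * x i)) t = (\<Prod>i\<in>I. char \<mu> (b i * t))"
proof -
  interpret real_distribution \<mu> by fact
  interpret P: product_prob_space "\<lambda>_. \<mu>" I ..
  have [measurable_cong]: "sets \<mu> = sets borel" by simp
  have [measurable]: "(\<lambda>x. \<Sum>i\<in>I. b i * x i) \<in> borel_measurable (PiM I (\<lambda>_. \<mu>))"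
    by measurable
  have "char (distr (PiM I (\<lambda>_. \<mu>)) borel (\<lambda>x. \<Sum>i\<in>I. b i * x i)) t
      = (CLINT x|PiM I (\<lambda>_. \<mu>). iexp (t * (\<Sum>i\<in>I. b i * x i)))"
    by (simp add: char_def integral_distr)
  also have "\<dots> = (CLINT x|PiM I (\<lambda>_. \<mu>). (\<Prod>i\<in>I. iexp (b i * t * x i)))"
    using assms(2) by (simp add: exp_sum sum_distrib_left mult_ac)
  also have "\<dots> = (\<Prod>i\<in>I. CLINT x|\<mu>. iexp (b i * t * x))"
    using assms(2) by (intro P.product_integral_prod integrable_iexp) auto
  finally show ?thesis by (simp add: char_def)
qed

text \<open>The chord of the exponential over \<open>[0, 2]\<close>, the range of
  \<open>1 - cos\<close>. With \<open>c = c3 / 2\<close> its slope is the laziness \<open>l\<close>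
  chosen below, so the right-hand side becomes one step of the lazy walk.\<close>

lemma exp_neg_le_linear:
  assumes "0 \<le> u" "u \<le> (2::real)"
  shows "exp (- (c * u)) \<le> 1 - (1 - exp (- (2 * c))) / 2 * u"
proof -
  have "exp ((1 - u/2) *\<^sub>R 0 + (u/2) *\<^sub>R (- (2 * c))) \<le> (1 - u/2) * exp 0 + u/2 * exp (- (2 * c))"
    using assms by (intro convex_onD[OF exp_convex]) auto
  then show ?thesis by (simp add: field_simps)
qed

text \<open>The average over \<open>\<xi> - \<xi>'\<close> in the exponent is moved outside by convexity of the exponential,
  after which one favourable value \<open>z\<close> of the difference can be fixed.\<close>

lemma linear_concentration:
  fixes b :: "nat \<Rightarrow> real"
  assumes \<mu>: "real_distribution \<mu>" and c3: "c3 > 0" and \<beta>: "\<beta> > 0"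
    and \<Omega>_ge: "measure (\<mu> \<Otimes>\<^sub>M \<mu>) {p \<in> space (\<mu> \<Otimes>\<^sub>M \<mu>). c1 \<le> \<bar>fst p - snd p\<bar> \<and> \<bar>fst p - snd p\<bar> \<le> c2} \<ge> c3"
    and l: "l = (1 - exp (- c3)) / 2"
  shows "\<exists>z. \<bar>z\<bar> \<ge> c1 \<and>
     measure (PiM {..<n} (\<lambda>_. \<mu>)) {x \<in> space (PiM {..<n} (\<lambda>_. \<mu>)). \<bar>(\<Sum>i<n. b i * x i) - a\<bar> \<le> \<beta>}
     \<le> 4 * (LINT g|std_normal_distribution. (\<Prod>i<n. 1 - l + l * cos (z / \<beta> * b i * g)))"
proof -
  interpret real_distribution \<mu> by fact
  interpret P: pair_prob_space \<mu> \<mu> ..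
  interpret PP: product_prob_space "\<lambda>_. \<mu>" "{..<n}" ..

  have [measurable_cong]: "sets \<mu> = sets borel" by simp
  let ?N = std_normal_distribution
  let ?MM = "\<mu> \<Otimes>\<^sub>M \<mu>"
  define \<Omega> where "\<Omega> = {p \<in> space ?MM. c1 \<le> \<bar>fst p - snd p\<bar> \<and> \<bar>fst p - snd p\<bar> \<le> c2}"
  have \<Omega>[measurable]: "\<Omega> \<in> sets ?MM" unfolding \<Omega>_def by measurable
  have [simp]: "\<Omega> \<inter> space ?MM = \<Omega>" using sets.sets_into_space[OF \<Omega>] by blast
  define \<pi> where "\<pi> = measure ?MM \<Omega>"
  have \<pi>: "\<pi> \<ge> c3" "\<pi> > 0" using \<Omega>_ge c3 by (auto simp: \<pi>_def \<Omega>_def)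
  define W where "W = (LINT g|?N. (\<Prod>i<n. norm (char \<mu> (b i * (g / \<beta>)))))"
  define F where "F = (\<lambda>z g. \<Prod>i<n. 1 - l + l * cos (z / \<beta> * b i * g))"
  define G where "G = (\<lambda>z. LINT g|?N. F z g)"
  have l01: "0 \<le> l" "l \<le> 1/2" using c3 by (auto simp: l)
  have f01: "0 \<le> 1 - l + l * cos t" "1 - l + l * cos t \<le> 1" for t
    using l01 mult_left_mono[OF cos_ge_minus_one[of t], of l] mult_left_mono[OF cos_le_one[of t], of l] by auto
  have F01: "0 \<le> F z g" "F z g \<le> 1" for z g
    unfolding F_def by (auto intro!: prod_nonneg prod_le_1 f01)
  have [measurable]: "(\<lambda>(p, g). F (fst p - snd p) g) \<in> borel_measurable (?MM \<Otimes>\<^sub>M ?N)"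
    unfolding F_def by measurable
  have meas[measurable]: "(\<lambda>p. F (fst p - snd p) g) \<in> borel_measurable ?MM" for g
    unfolding F_def by measurable
  have key: "\<pi> * (\<Prod>i<n. norm (char \<mu> (b i * (g / \<beta>)))) \<le> (LINT p|?MM. indicator \<Omega> p * F (fst p - snd p) g)" for g
  proof -
    define u where "u = (\<lambda>i p. 1 - cos (b i * (g / \<beta>) * (fst p - snd p :: real)))"
    define h where "h = (\<lambda>p. - (c3 / 2) * (\<Sum>i<n. u i p))"
    define A where "A = (LINT p|?MM. indicator \<Omega> p * (\<Sum>i<n. u i p))"
    \<comment> \<open>The mean of \<open>h\<close> conditional on \<open>\<Omega>\<close>.\<close>
    define a where "a = - (c3 / 2) * A / \<pi>"
    have u02: "0 \<le> u i p" "u i p \<le> 2" for i p unfolding u_def using cos_ge_minus_one[of "b i * (g / \<beta>) * (fst p - snd p :: real)"] by auto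
    have [measurable]: "u i \<in> borel_measurable ?MM" for i unfolding u_def by measurable
    have intu: "integrable ?MM (\<lambda>p. indicator \<Omega> p * u i p)" for i
      by (intro P.P.integrable_const_bound[of _ 2] AE_I2) (use u02 in \<open>auto simp: indicator_def abs_le_iff\<close>)
    have A: "A = (\<Sum>i<n. LINT p|?MM. indicator \<Omega> p * u i p)"
      unfolding A_def sum_distrib_left by (intro Bochner_Integration.integral_sum intu)
    have A0: "A \<ge> 0" unfolding A using u02 by (intro sum_nonneg Bochner_Integration.integral_nonneg) auto
    have hmeas[measurable]: "h \<in> borel_measurable ?MM" unfolding h_def by measurable
    have h0: "h p \<le> 0" for p
    proof -
      have "0 \<le> (\<Sum>i<n. u i p)" by (intro sum_nonneg u02)
      then show ?thesis using c3 by (simp add: h_def)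
    qed
    have hn: "h p \<ge> - (c3 * n)" for p
    proof -
      have "(\<Sum>i<n. u i p) \<le> (\<Sum>i<n. 2)" using u02 by (intro sum_mono)
      then show ?thesis using c3 by (simp add: h_def)
    qed
    have inth: "integrable ?MM (\<lambda>p. indicator \<Omega> p * h p)"
    proof (intro P.P.integrable_const_bound[of _ "c3 * n"] AE_I2)
      show "norm (indicator \<Omega> p * h p) \<le> c3 * n" for p
        using h0[of p] hn[of p] c3 by (auto simp: indicator_def)
    qed measurable
    have inteh: "integrable ?MM (\<lambda>p. indicator \<Omega> p * exp (h p))"
      by (intro P.P.integrable_const_bound[of _ 1] AE_I2) (use h0 in \<open>auto simp: indicator_def\<close>)
    have int1: "integrable ?MM (\<lambda>p. indicator \<Omega> p :: real)"
      by (intro P.P.integrable_const_bound[of _ 1]) auto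
    have "(\<Prod>i<n. norm (char \<mu> (b i * (g / \<beta>)))) \<le> (\<Prod>i<n. exp (- (LINT p|?MM. indicator \<Omega> p * u i p) / 2))"
      unfolding u_def by (intro prod_mono conjI norm_char_le_exp \<mu> \<Omega>) auto
    also have "\<dots> = exp (- A / 2)"
      unfolding A by (simp add: exp_sum[symmetric] sum_negf sum_divide_distrib)
    \<comment> \<open>Here \<open>c3 <= \<pi>\<close> weakens the exponent, so that the laziness
      depends on \<open>c3\<close> and not on the law.\<close>
    also have "\<dots> \<le> exp a"
    proof -
      have "c3 * A \<le> \<pi> * A" using A0 \<pi> by (intro mult_right_mono) auto
      then show ?thesis using \<pi> by (simp add: a_def field_simps)
    qed
    finally have 1: "\<pi> * (\<Prod>i<n. norm (char \<mu> (b i * (g / \<beta>)))) \<le> \<pi> * exp a" using \<pi> by simp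
    \<comment> \<open>Jensen's inequality on \<open>\<Omega>\<close> by hand:
      \<open>exp (h p)\<close> lies above the tangent of the exponential at the mean
      \<open>a\<close>.\<close>
    have "\<pi> * exp a = exp a * ((1 - a) * \<pi> + (- (c3 / 2)) * A)"
      using \<pi> by (simp add: a_def field_simps)
    also have "\<dots> = (LINT p|?MM. exp a * ((1 - a) * indicator \<Omega> p + indicator \<Omega> p * h p))"
    proof -
      have "(LINT p|?MM. indicator \<Omega> p * h p) = - (c3 / 2) * A"
        unfolding A_def h_def by (subst integral_mult_right_zero[symmetric]) (simp add: mult_ac)
      then show ?thesis using inth int1 by (simp add: \<pi>_def)
    qed
    also have "\<dots> \<le> (LINT p|?MM. indicator \<Omega> p * exp (h p))"
    proof (intro integral_mono inteh)
      show "integrable ?MM (\<lambda>p. exp a * ((1 - a) * indicator \<Omega> p + indicator \<Omega> p * h p))"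
        using inth int1 by auto
      fix p
      have "exp a * (1 + (h p - a)) \<le> exp a * exp (h p - a)"
        using exp_ge_add_one_self by (intro mult_left_mono) auto
      then have "exp a * (1 - a + h p) \<le> exp (h p)" by (simp add: exp_add[symmetric] algebra_simps)
      then show "exp a * ((1 - a) * indicator \<Omega> p + indicator \<Omega> p * h p) \<le> indicator \<Omega> p * exp (h p)"
        by (auto simp: indicator_def)
    qed
    also have "\<dots> \<le> (LINT p|?MM. indicator \<Omega> p * F (fst p - snd p) g)"
    proof (intro integral_mono inteh)
      show "integrable ?MM (\<lambda>p. indicator \<Omega> p * F (fst p - snd p) g)"
        by (intro P.P.integrable_const_bound[of _ 1] AE_I2) (use F01 in \<open>auto simp: indicator_def\<close>)
      fix p
      have "exp (h p) = (\<Prod>i<n. exp (- (c3 / 2 * u i p)))"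
        by (simp add: h_def exp_sum[symmetric] sum_distrib_left sum_negf)
      also have "\<dots> \<le> F (fst p - snd p) g"
        unfolding F_def
      proof (intro prod_mono conjI)
        fix i
        show "exp (- (c3 / 2 * u i p)) \<le> 1 - l + l * cos ((fst p - snd p) / \<beta> * b i * g)"
          using exp_neg_le_linear[OF u02(1,2), of "c3/2" i p]
          by (simp add: l u_def algebra_simps diff_divide_distrib)
      qed auto
      finally show "indicator \<Omega> p * exp (h p) \<le> indicator \<Omega> p * F (fst p - snd p) g"
        by (auto simp: indicator_def)
    qed
    finally show ?thesis using 1 by linarith
  qed
  interpret Q: pair_prob_space ?MM ?N ..
  have [measurable]: "(\<lambda>g. char \<mu> (b i * (g / \<beta>))) \<in> borel_measurable ?N" for i
    using char_measurable by measurable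
  have int2: "integrable (?MM \<Otimes>\<^sub>M ?N) (\<lambda>(p, g). indicator \<Omega> p * F (fst p - snd p) g)"
    by (intro Q.P.integrable_const_bound[of _ 1] AE_I2) (use F01 in \<open>auto simp: indicator_def\<close>)
  have "measure (PiM {..<n} (\<lambda>_. \<mu>)) {x \<in> space (PiM {..<n} (\<lambda>_. \<mu>)). \<bar>(\<Sum>i<n. b i * x i) - a\<bar> \<le> \<beta>}
     \<le> exp (1/2) * (LINT g|?N. norm (char (distr (PiM {..<n} (\<lambda>_. \<mu>)) borel (\<lambda>x. \<Sum>i<n. b i * x i)) (g / \<beta>)))"
    by (intro prob_space.concentration_le_char[OF PP.prob_space_axioms] \<beta>) measurable
  also have "\<dots> = exp (1/2) * W"
    unfolding W_def by (subst char_linear_PiM[OF \<mu>]) (auto simp: prod_norm)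
  finally have conc: "measure (PiM {..<n} (\<lambda>_. \<mu>)) {x \<in> space (PiM {..<n} (\<lambda>_. \<mu>)). \<bar>(\<Sum>i<n. b i * x i) - a\<bar> \<le> \<beta>} \<le> exp (1/2) * W" .
  have W: "\<pi> * W \<le> (LINT p|?MM. indicator \<Omega> p * G (fst p - snd p))"
  proof -
    have "\<pi> * W = (LINT g|?N. \<pi> * (\<Prod>i<n. norm (char \<mu> (b i * (g / \<beta>)))))"
      by (simp add: W_def)
    also have "\<dots> \<le> (LINT g|?N. LINT p|?MM. indicator \<Omega> p * F (fst p - snd p) g)"
    proof (intro integral_mono key)
      show "integrable ?N (\<lambda>g. \<pi> * (\<Prod>i<n. norm (char \<mu> (b i * (g / \<beta>)))))"
        by (intro integrable_mult_right std_normal.integrable_const_bound[of _ 1] AE_I2)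
           (auto simp: prod_norm[symmetric] abs_prod intro!: prod_le_1 cmod_char_le_1)
      show "integrable ?N (\<lambda>g. LINT p|?MM. indicator \<Omega> p * F (fst p - snd p) g)"
        using Q.integrable_snd[OF int2] by simp
    qed
    also have "\<dots> = (LINT p|?MM. LINT g|?N. indicator \<Omega> p * F (fst p - snd p) g)"
      using Q.Fubini_integral[OF int2] by simp
    finally show ?thesis by (simp add: G_def)
  qed
  \<comment> \<open>Giving up a factor 2 avoids a strict comparison of integrals: a contradiction
    follows already from \<open>\<pi> * W <= \<pi> * W / 2\<close>. Together with
    \<open>exp (1/2) <= 2\<close> this makes the constant 4.\<close>
  have "\<exists>p\<in>\<Omega>. G (fst p - snd p) \<ge> W / 2"
  proof (rule ccontr)
    assume "\<not> ?thesis"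
    then have less: "\<And>p. p \<in> \<Omega> \<Longrightarrow> G (fst p - snd p) < W / 2" by force
    have "\<Omega> \<noteq> {}" using \<pi> by (auto simp: \<pi>_def)
    then obtain p0 where "p0 \<in> \<Omega>" by blast
    have "0 \<le> G z" for z unfolding G_def using F01 by (intro Bochner_Integration.integral_nonneg) auto
    then have Wpos: "W > 0" using less[OF \<open>p0 \<in> \<Omega>\<close>] by (smt (verit) half_gt_zero_iff)
    have "(LINT p|?MM. indicator \<Omega> p * G (fst p - snd p)) \<le> (LINT p|?MM. indicator \<Omega> p * (W / 2))"
    proof (intro integral_mono)
      show "integrable ?MM (\<lambda>p. indicator \<Omega> p * G (fst p - snd p))"
        using Q.integrable_fst[OF int2] by (simp add: G_def)
      show "integrable ?MM (\<lambda>p. indicator \<Omega> p * (W / 2))"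
        by (intro P.P.integrable_const_bound[of _ "\<bar>W\<bar>"]) (auto simp: indicator_def)
      fix p show "indicator \<Omega> p * G (fst p - snd p) \<le> indicator \<Omega> p * (W / 2)"
        using less[of p] by (auto simp: indicator_def)
    qed
    also have "\<dots> = \<pi> * W / 2" by (simp add: \<pi>_def)
    finally have "\<pi> * W \<le> \<pi> * W / 2" using W by linarith
    then show False using mult_pos_pos[OF \<pi>(2) Wpos] by linarith
  qed
  then obtain p where p: "p \<in> \<Omega>" "G (fst p - snd p) \<ge> W / 2" by blast
  have "exp (1/2) \<le> (2::real)"
  proof -
    have "exp (1/2 :: real) ^ 2 = exp 1" by (simp add: exp_double[symmetric])
    also have "\<dots> \<le> 2 ^ 2" using exp_le by simp
    finally show ?thesis by (rule power2_le_imp_le) simp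
  qed
  moreover have "W \<ge> 0" unfolding W_def by (intro Bochner_Integration.integral_nonneg) (auto intro!: prod_nonneg)
  ultimately have "exp (1/2) * W \<le> 2 * W" by (intro mult_right_mono)
  also have "\<dots> \<le> 4 * G (fst p - snd p)" using p by simp
  finally show ?thesis using conc p(1) unfolding G_def F_def \<Omega>_def
    by (intro exI[of _ "fst p - snd p"]) auto
qed

subsection \<open>Trading indices for copies\<close>

text \<open>The inequality of the means for the powers \<open>x i ^ card T\<close>, whose geometric
  mean is the product itself.\<close>

lemma prod_le_mean_power:
  fixes x :: "'i \<Rightarrow> real"
  assumes "finite T" "T \<noteq> {}" "\<And>i. i \<in> T \<Longrightarrow> x i > 0"
  shows "(\<Prod>i\<in>T. x i) \<le> (\<Sum>i\<in>T. x i ^ card T / card T)"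
proof -
  have c: "card T > 0" using assms by (simp add: card_gt_0_iff)
  have "(\<Prod>i\<in>T. x i) = exp (\<Sum>i\<in>T. (1 / card T) *\<^sub>R (card T * ln (x i)))"
    using assms c by (simp add: exp_sum)
  also have "\<dots> \<le> (\<Sum>i\<in>T. (1 / card T) * exp (card T * ln (x i)))"
    using assms c by (intro convex_on_sum[OF _ _ exp_convex]) auto
  also have "\<dots> = (\<Sum>i\<in>T. x i ^ card T / card T)"
    using assms by (intro sum.cong) (auto simp: exp_of_nat_mult)
  finally show ?thesis .
qed

text \<open>The outcome of \<open>linear_concentration\<close>: \<open>z\<close> is the fixed value
  of the difference, \<open>V\<close> the lower bound for the smoothed concentration, and
  \<open>L\<close> the length of the walks to be run. The strict bound \<open>l < 1/2\<close> keeps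
  every factor positive, as the inequality of the means requires.\<close>

locale concentrated =
  fixes n L :: nat and b :: "nat \<Rightarrow> real" and z \<beta> c1 l V :: real
  assumes L: "L > 0" and c1: "0 < c1" "c1 \<le> \<bar>z\<bar>" and \<beta>: "\<beta> > 0" and l: "0 < l" "l < 1/2"
    and V_le: "V \<le> (LINT g|std_normal_distribution. (\<Prod>i<n. 1 - l + l * cos (z / \<beta> * b i * g)))"
begin

definition \<psi> :: "nat \<Rightarrow> real \<Rightarrow> real" where
  "\<psi> i g = 1 - l + l * cos (z / \<beta> * b i * g)"

lemma \<psi>_pos: "\<psi> i g > 0"
  using l mult_left_mono[OF cos_ge_minus_one[of "z / \<beta> * b i * g"], of l] by (simp add: \<psi>_def)

lemma \<psi>_le_1: "\<psi> i g \<le> 1"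
  using l mult_left_mono[OF cos_le_one[of "z / \<beta> * b i * g"], of l] by (simp add: \<psi>_def)

lemma \<psi>_power_nonneg: "0 \<le> \<psi> i g ^ k"
  using \<psi>_pos[of i g] by simp

lemma \<psi>_measurable [measurable]: "\<psi> i \<in> borel_measurable borel"
  unfolding \<psi>_def by measurable

text \<open>The integrand when each index of \<open>U\<close> carries a walk of \<open>L\<close>
  steps and each index of \<open>Y\<close> still carries a single step.\<close>

definition profile :: "nat set \<Rightarrow> nat set \<Rightarrow> real \<Rightarrow> real" where
  "profile U Y g = (\<Prod>j\<in>U. \<psi> j g ^ L) * (\<Prod>i\<in>Y. \<psi> i g)"

lemma profile_bounds: "0 \<le> profile U Y g" "profile U Y g \<le> 1"
  unfolding profile_def
  by (auto intro!: mult_nonneg_nonneg prod_nonneg mult_le_one prod_le_1 power_le_one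
        less_imp_le[OF \<psi>_pos] \<psi>_le_1 \<psi>_power_nonneg)

lemma integrable_profile: "integrable std_normal_distribution (profile U Y)"
proof (rule std_normal.integrable_const_bound[of _ 1])
  show "profile U Y \<in> borel_measurable std_normal_distribution"
    unfolding profile_def by measurable
qed (use profile_bounds in auto)

text \<open>The indices in \<open>X\<close> have been traded for \<open>L\<close> copies of each of the indices in \<open>U\<close>.\<close>

definition traded :: "nat set \<Rightarrow> nat set \<Rightarrow> bool" where
  "traded U X \<longleftrightarrow> U \<subseteq> X \<and> X \<subseteq> {..<n} \<and> card X \<le> L * card U \<and>
     V \<le> (LINT g|std_normal_distribution. profile U ({..<n} - X) g)"

lemma traded_empty: "traded {} {}"
  using V_le by (simp add: traded_def profile_def \<psi>_def)

text \<open>For \<open>L\<close> indices of \<open>S\<close>, the inequality of the means bounds the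
  integrand by the average of those in which one of the \<open>L\<close> indices replaces all. Some
  index attains at least the average; all \<open>L\<close> count as spent.\<close>

lemma traded_step:
  assumes tr: "traded U X" and S: "S \<subseteq> {..<n} - X" "card S \<ge> L"
  shows "\<exists>u\<in>S. \<exists>X'. traded (insert u U) X' \<and> X \<subseteq> X'"
proof -
  let ?E = "\<lambda>f. LINT g|std_normal_distribution. f g"
  obtain T where T: "T \<subseteq> S" "card T = L" "finite T"
    using obtain_subset_with_card_n[OF S(2)] by metis
  define R where "R = {..<n} - (X \<union> T)"
  have split: "{..<n} - X = T \<union> R" "T \<inter> R = {}" "finite R" using T S unfolding R_def by auto
  have fin: "finite X" "finite U" using tr unfolding traded_def by (auto intro: finite_subset)
  have uU: "u \<notin> U" if "u \<in> T" for u using that T S tr unfolding traded_def by auto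
  have "V \<le> ?E (profile U ({..<n} - X))" using tr by (simp add: traded_def)
  also have "\<dots> \<le> ?E (\<lambda>g. \<Sum>u\<in>T. profile (insert u U) R g / L)"
  proof (intro integral_mono integrable_profile Bochner_Integration.integrable_sum)
    fix g
    have "profile U ({..<n} - X) g = (\<Prod>j\<in>U. \<psi> j g ^ L) * (\<Prod>i\<in>R. \<psi> i g) * (\<Prod>i\<in>T. \<psi> i g)"
      using split T unfolding profile_def by (simp add: prod.union_disjoint mult_ac)
    also have "\<dots> \<le> (\<Prod>j\<in>U. \<psi> j g ^ L) * (\<Prod>i\<in>R. \<psi> i g) * (\<Sum>u\<in>T. \<psi> u g ^ L / L)"
      using prod_le_mean_power[of T "\<lambda>i. \<psi> i g"] T L \<psi>_pos card_gt_0_iff[of T]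
      by (intro mult_left_mono mult_nonneg_nonneg prod_nonneg) (auto intro: less_imp_le)
    also have "\<dots> = (\<Sum>u\<in>T. profile (insert u U) R g / L)"
      unfolding sum_distrib_left using uU fin by (intro sum.cong) (auto simp: profile_def mult_ac)
    finally show "profile U ({..<n} - X) g \<le> (\<Sum>u\<in>T. profile (insert u U) R g / L)" .
  qed (auto intro: integrable_profile)
  also have "\<dots> = (\<Sum>u\<in>T. ?E (profile (insert u U) R) / L)"
    by (subst Bochner_Integration.integral_sum) (auto intro: integrable_profile)
  finally have le: "V \<le> (\<Sum>u\<in>T. ?E (profile (insert u U) R) / L)" .
  have "\<exists>u\<in>T. V \<le> ?E (profile (insert u U) R)"
  proof (rule ccontr)
    assume "\<not> ?thesis"
    then have "(\<Sum>u\<in>T. ?E (profile (insert u U) R) / L) < (\<Sum>u\<in>T. V / L)"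
      using T L by (intro sum_strict_mono) (auto simp: divide_strict_right_mono not_le)
    then show False using le T L by simp
  qed
  then obtain u where u: "u \<in> T" "V \<le> ?E (profile (insert u U) R)" by blast
  have "card (X \<union> T) \<le> L * card U + L"
    using card_Un_le[of X T] tr T unfolding traded_def by linarith
  then have "traded (insert u U) (X \<union> T)"
    using u uU[OF u(1)] fin tr T S unfolding traded_def R_def by (auto simp: algebra_simps)
  then show ?thesis using u T by blast
qed

section \<open>Displacements of the walks along a traded family\<close>

abbreviation box :: "nat set \<Rightarrow> (nat \<Rightarrow> int) set" where
  "box U \<equiv> PiE U (\<lambda>_. {-int L..int L})"

abbreviation walk_weight :: "nat set \<Rightarrow> (nat \<Rightarrow> int) \<Rightarrow> real" where
  "walk_weight U m \<equiv> (\<Prod>j\<in>U. lazy_walk l L (m j))"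

lemma walk_weight_nonneg: "0 \<le> walk_weight U m"
  using l by (intro prod_nonneg lazy_walk_nonneg) auto

lemma sum_walk_weight:
  assumes "finite U"
  shows "(\<Sum>m\<in>box U. walk_weight U m) = 1"
proof -
  have "(\<Sum>m\<in>box U. walk_weight U m) = (\<Prod>j\<in>U. \<Sum>m\<in>{-int L..int L}. lazy_walk l L m)"
    using assms by (intro prod_sum_PiE[symmetric]) auto
  then show ?thesis by (simp add: lazy_walk_sum)
qed

text \<open>The factors of the untraded indices are at most 1 and are dropped. In the resulting
  Gaussian average over endpoints the weight is at most 1 near the origin; beyond
  \<open>\<beta> * K\<close> it is at most \<open>exp (- (c1 * K)^2 / 2)\<close>, because
  \<open>c1\<close> bounds \<open>z\<close> from below in absolute value.\<close>

lemma traded_concentration: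
  assumes "traded U X" "K > 0"
  shows "V \<le> (\<Sum>m\<in>{m\<in>box U. \<bar>\<Sum>j\<in>U. of_int (m j) * b j\<bar> \<le> \<beta> * K}. walk_weight U m)
              + exp (- (c1 * K)\<^sup>2 / 2)"
proof -
  let ?N = std_normal_distribution
  have fin: "finite U" using assms(1) unfolding traded_def by (auto intro: finite_subset)
  have finb: "finite (box U)" using fin by (intro finite_PiE) auto
  define s where "s m = (\<Sum>j\<in>U. of_int (m j) * b j)" for m :: "nat \<Rightarrow> int"
  have "V \<le> (LINT g|?N. profile U ({..<n} - X) g)" using assms by (simp add: traded_def)
  also have "\<dots> \<le> (LINT g|?N. profile U {} g)"
  proof (intro integral_mono integrable_profile)
    fix g show "profile U ({..<n} - X) g \<le> profile U {} g"
      unfolding profile_def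
      by (intro mult_left_mono)
         (auto intro!: prod_le_1 prod_nonneg \<psi>_le_1 \<psi>_power_nonneg less_imp_le[OF \<psi>_pos])
  qed
  also have "\<dots> = (\<Sum>m\<in>box U. walk_weight U m * exp (- (\<Sum>j\<in>U. of_int (m j) * (z / \<beta> * b j))\<^sup>2 / 2))"
    unfolding profile_def \<psi>_def using std_normal_integral_walk_prod[OF fin, of l "\<lambda>j. z / \<beta> * b j" L]
    by simp
  also have "\<dots> = (\<Sum>m\<in>box U. walk_weight U m * exp (- (z / \<beta> * s m)\<^sup>2 / 2))"
    by (simp add: s_def sum_distrib_left mult_ac)
  also have "\<dots> \<le> (\<Sum>m\<in>box U. (if \<bar>s m\<bar> \<le> \<beta> * K then walk_weight U m else 0)
                      + walk_weight U m * exp (- (c1 * K)\<^sup>2 / 2))"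
  proof (rule sum_mono)
    fix m
    show "walk_weight U m * exp (- (z / \<beta> * s m)\<^sup>2 / 2)
      \<le> (if \<bar>s m\<bar> \<le> \<beta> * K then walk_weight U m else 0) + walk_weight U m * exp (- (c1 * K)\<^sup>2 / 2)"
    proof (cases "\<bar>s m\<bar> \<le> \<beta> * K")
      case True
      have "walk_weight U m * exp (- (z / \<beta> * s m)\<^sup>2 / 2) \<le> walk_weight U m * 1"
        by (intro mult_left_mono walk_weight_nonneg) auto
      moreover have "0 \<le> walk_weight U m * exp (- (c1 * K)\<^sup>2 / 2)"
        by (intro mult_nonneg_nonneg walk_weight_nonneg) auto
      ultimately show ?thesis using True by simp
    next
      case False
      have "c1 * (\<beta> * K) \<le> \<bar>z\<bar> * \<bar>s m\<bar>"
        using False c1 \<beta> assms by (intro mult_mono) auto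
      then have "c1 * K \<le> \<bar>z / \<beta> * s m\<bar>" using \<beta> by (simp add: abs_mult field_simps)
      then have "(c1 * K)\<^sup>2 \<le> (z / \<beta> * s m)\<^sup>2"
        using c1 assms by (metis abs_le_square_iff abs_of_nonneg less_imp_le mult_nonneg_nonneg)
      then show ?thesis using False by (auto intro!: mult_left_mono walk_weight_nonneg)
    qed
  qed
  also have "\<dots> = (\<Sum>m\<in>{m\<in>box U. \<bar>s m\<bar> \<le> \<beta> * K}. walk_weight U m) + exp (- (c1 * K)\<^sup>2 / 2)"
    using finb by (simp add: sum.distrib sum.If_cases sum_walk_weight[OF fin] Int_def flip: sum_distrib_right)
  finally show ?thesis unfolding s_def .
qed

subsection \<open>Dissociated families\<close>

text \<open>Quantitative linear independence over the integers. One parameter bounds the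
  coefficients and, in units of \<open>\<beta>\<close>, the tolerance, so a single scale has to be
  tracked.\<close>

definition dissociated :: "real \<Rightarrow> nat set \<Rightarrow> bool" where
  "dissociated \<kappa> U \<longleftrightarrow> (\<forall>m::nat \<Rightarrow> int. (\<forall>j\<in>U. \<bar>of_int (m j)\<bar> \<le> \<kappa>) \<longrightarrow>
     \<bar>\<Sum>j\<in>U. of_int (m j) * b j\<bar> \<le> \<beta> * \<kappa> \<longrightarrow> (\<forall>j\<in>U. m j = 0))"

lemma dissociatedD:
  fixes m :: "nat \<Rightarrow> int"
  assumes "dissociated \<kappa> U" "\<And>j. j \<in> U \<Longrightarrow> \<bar>real_of_int (m j)\<bar> \<le> \<kappa>"
    "\<bar>\<Sum>j\<in>U. of_int (m j) * b j\<bar> \<le> \<beta> * \<kappa>" "j \<in> U"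
  shows "m j = 0"
  using assms unfolding dissociated_def by blast

lemma dissociated_mono:
  assumes "dissociated \<kappa> U" "\<kappa>' \<le> \<kappa>"
  shows "dissociated \<kappa>' U"
  unfolding dissociated_def
proof (intro allI impI ballI)
  fix m :: "nat \<Rightarrow> int" and j
  assume h: "\<forall>j\<in>U. \<bar>real_of_int (m j)\<bar> \<le> \<kappa>'" "\<bar>\<Sum>j\<in>U. of_int (m j) * b j\<bar> \<le> \<beta> * \<kappa>'" "j \<in> U"
  have "\<beta> * \<kappa>' \<le> \<beta> * \<kappa>" using assms \<beta> by simp
  then show "m j = 0" using h assms by (intro dissociatedD[of \<kappa> U m]) force+
qed

lemma box_le: "m \<in> box U \<Longrightarrow> j \<in> U \<Longrightarrow> \<bar>real_of_int (m j)\<bar> \<le> real L"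
proof -
  assume "m \<in> box U" "j \<in> U"
  then have "m j \<in> {-int L..int L}" by (rule PiE_mem)
  then have "\<bar>m j\<bar> \<le> int L" by auto
  then show ?thesis by linarith
qed

text \<open>Only the walk with all displacements zero ends near the origin, and its weight is the
  product of the return probabilities.\<close>

lemma dissociated_concentration:
  fixes \<kappa> K :: real
  assumes tr: "traded U X" and dis: "dissociated \<kappa> U" and K: "0 < K" "K \<le> \<kappa>" "L \<le> \<kappa>"
  shows "V \<le> lazy_walk l L 0 ^ card U + exp (- (c1 * K)\<^sup>2 / 2)"
proof -
  let ?Z = "{m\<in>box U. \<bar>\<Sum>j\<in>U. of_int (m j) * b j\<bar> \<le> \<beta> * K}"
  have "m = (\<lambda>j\<in>U. 0)" if m: "m \<in> ?Z" for m
  proof -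
    have "\<bar>real_of_int (m j)\<bar> \<le> \<kappa>" if "j \<in> U" for j
      using box_le[of m U j] that m K by auto
    moreover have "\<bar>\<Sum>j\<in>U. of_int (m j) * b j\<bar> \<le> \<beta> * \<kappa>"
      using m \<beta> by (intro order_trans[OF _ mult_left_mono[OF K(2)]]) auto
    ultimately have "m j = 0" if "j \<in> U" for j using that dissociatedD[OF dis, of m j] by blast
    then show ?thesis using m by (auto simp: PiE_def extensional_def fun_eq_iff)
  qed
  then have "?Z \<subseteq> {\<lambda>j\<in>U. 0}" by blast
  then have "(\<Sum>m\<in>?Z. walk_weight U m) \<le> (\<Sum>m\<in>{\<lambda>j\<in>U. 0}. walk_weight U m)"
    by (intro sum_mono2 walk_weight_nonneg) auto
  also have "\<dots> = lazy_walk l L 0 ^ card U" by simp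
  finally show ?thesis using traded_concentration[OF tr K(1)] by linarith
qed

text \<open>Dissociated traded families cannot reach size \<open>d\<close>, so at some size
  \<open>r\<close> the growth stops. Then fewer than \<open>L\<close> indices outside
  \<open>X\<close> can still be added, and \<open>X\<close> itself has at most \<open>L * r\<close>
  elements. The scale depends on the size, so that independence can later be assumed at a much
  larger scale than the dependences found.\<close>

lemma maximal_dissociated:
  fixes \<kappa> :: "nat \<Rightarrow> real" and K :: real
  assumes \<kappa>: "\<And>r. r \<le> d \<Longrightarrow> K \<le> \<kappa> r" "\<And>r. r \<le> d \<Longrightarrow> L \<le> \<kappa> r" and K: "0 < K"
    and V: "lazy_walk l L 0 ^ d + exp (- (c1 * K)\<^sup>2 / 2) < V"
  shows "\<exists>I0. I0 \<subseteq> {..<n} \<and> card I0 < d \<and> dissociated (\<kappa> (card I0)) I0 \<and>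
     card {i\<in>{..<n} - I0. dissociated (\<kappa> (Suc (card I0))) (insert i I0)} \<le> L * (d + 1)"
proof -
  define Q where "Q r \<longleftrightarrow> (\<exists>U X. traded U X \<and> card U = r \<and> dissociated (\<kappa> r) U)" for r
  have "Q 0" unfolding Q_def using traded_empty by (auto simp: dissociated_def)
  moreover have "\<not> Q d"
  proof
    assume "Q d"
    then obtain U X where "traded U X" "card U = d" "dissociated (\<kappa> d) U" unfolding Q_def by blast
    then show False using dissociated_concentration[of U X "\<kappa> d" K] \<kappa>[of d] K V by simp
  qed
  ultimately obtain r where r: "r < d" "Q r" "\<not> Q (Suc r)"
    using ex_least_nat_less[of "\<lambda>r. \<not> Q r" d] by blast
  then obtain U X where U: "traded U X" "card U = r" "dissociated (\<kappa> r) U" unfolding Q_def by blast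
  have UX: "U \<subseteq> X" "X \<subseteq> {..<n}" "card X \<le> L * card U" and fin: "finite U" "finite X"
    using U(1) unfolding traded_def by (auto intro: finite_subset)
  let ?S = "{i\<in>{..<n} - X. dissociated (\<kappa> (Suc r)) (insert i U)}"
  have "card ?S < L"
  proof (rule ccontr)
    assume "\<not> ?thesis"
    then obtain u X' where u: "u \<in> ?S" "traded (insert u U) X'"
      using traded_step[OF U(1), of ?S] by (metis (no_types, lifting) linorder_not_less mem_Collect_eq subsetI)
    then have "card (insert u U) = Suc r" using UX fin U(2) by (subst card_insert_disjoint) auto
    then show False using r u unfolding Q_def by blast
  qed
  moreover have "card {i\<in>{..<n} - U. dissociated (\<kappa> (Suc r)) (insert i U)} \<le> card (?S \<union> X)"
    using fin by (intro card_mono) auto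
  moreover have "L * r \<le> L * d" using r by simp
  ultimately have "card {i\<in>{..<n} - U. dissociated (\<kappa> (Suc r)) (insert i U)} \<le> L * (d + 1)"
    using card_Un_le[of ?S X] UX(3) U(2) by (simp only: distrib_left)
  then show ?thesis using U UX r by (intro exI[of _ U]) auto
qed

text \<open>If \<open>d\<close> is the order of \<open>v u\<close> modulo the vectors with denominator \<open>D\<close>, then adding \<open>u\<close> to
  \<open>U\<close> pins the \<open>u\<close>-th coordinate of the walk to one residue class modulo \<open>d\<close>.\<close>

lemma residue_weight_insert:
  fixes v :: "nat \<Rightarrow> nat \<Rightarrow> real" and w :: real and D d :: nat
  assumes fin: "finite U" and u: "u \<notin> U" and d: "d > 0"
    and D: "\<And>i j. i \<in> U \<Longrightarrow> j \<in> I0 \<Longrightarrow> real D * v i j \<in> \<int>"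
    and ord: "\<And>s::int. (\<And>j. j \<in> I0 \<Longrightarrow> of_int s * (real D * v u j) \<in> \<int>) \<Longrightarrow> int d dvd s"
    and w: "\<And>q. (\<Sum>m\<in>{m\<in>box U. \<forall>j\<in>I0. (\<Sum>i\<in>U. of_int (m i) * v i j) - q j \<in> \<int>}. walk_weight U m) \<le> w"
  shows "(\<Sum>m\<in>{m\<in>box (insert u U). \<forall>j\<in>I0. (\<Sum>i\<in>insert u U. of_int (m i) * v i j) - q j \<in> \<int>}.
       walk_weight (insert u U) m) \<le> (1 / d + 2 * lazy_walk l L 0) * w"
proof -
  \<comment> \<open>Fixing the displacement \<open>t\<close> along \<open>u\<close> leaves a
    congruence for \<open>U\<close> with a shifted target; hence \<open>w\<close> has to bound the
    weight for all targets \<open>q\<close>.\<close>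
  define C where "C t = {m\<in>box U. \<forall>j\<in>I0. (\<Sum>i\<in>U. of_int (m i) * v i j) - (q j - of_int t * v u j) \<in> \<int>}" for t :: int
  define T where "T = {t\<in>{-int L..int L}. C t \<noteq> {}}"
  have finC: "finite (C t)" for t unfolding C_def using fin by (auto intro!: finite_PiE)
  have w0: "w \<ge> 0" by (rule order_trans[OF _ w[of "\<lambda>_. 0"]]) (intro sum_nonneg walk_weight_nonneg)
  have sum_upd: "(\<Sum>i\<in>insert u U. of_int ((m(u := t)) i) * v i j) = of_int t * v u j + (\<Sum>i\<in>U. of_int (m i) * v i j)" for m t j
    using u fin by (simp cong: sum.cong) (intro sum.cong, auto)
  have prod_upd: "walk_weight (insert u U) (m(u := t)) = lazy_walk l L t * walk_weight U m" for m t
  proof -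
    have "(\<Prod>j\<in>U. lazy_walk l L ((m(u := t)) j)) = walk_weight U m"
      using u by (intro prod.cong) auto
    then show ?thesis using u fin by simp
  qed
  have "(\<Sum>m\<in>{m\<in>box (insert u U). \<forall>j\<in>I0. (\<Sum>i\<in>insert u U. of_int (m i) * v i j) - q j \<in> \<int>}.
       walk_weight (insert u U) m)
     = (\<Sum>(t, m)\<in>Sigma {-int L..int L} C. lazy_walk l L t * walk_weight U m)"
  proof (rule sum.reindex_bij_witness[of _ "\<lambda>(t, m). m(u := t)" "\<lambda>m. (m u, m(u := undefined))"], goal_cases)
    case (2 m)
    then have m: "m \<in> box (insert u U)" and c: "\<forall>j\<in>I0. (\<Sum>i\<in>insert u U. of_int (m i) * v i j) - q j \<in> \<int>" by auto
    have 1: "m(u := undefined) \<in> box U" using m u by (auto simp: PiE_def extensional_def)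
    have 2: "(\<Sum>i\<in>U. of_int ((m(u := undefined)) i) * v i j) - (q j - of_int (m u) * v u j)
        = (\<Sum>i\<in>insert u U. of_int (m i) * v i j) - q j" for j
      using sum_upd[of "m(u := undefined)" "m u" j] by simp
    have "m(u := undefined) \<in> C (m u)" unfolding C_def mem_Collect_eq 2 using 1 c by blast
    then show ?case using m by auto
  next
    case (4 tm)
    then obtain t m where tm: "tm = (t, m)" "t \<in> {-int L..int L}" "m \<in> C t" by auto
    have "m(u := t) \<in> box (insert u U)" using tm unfolding C_def by (auto simp: PiE_def extensional_def)
    moreover have "\<forall>j\<in>I0. (\<Sum>i\<in>insert u U. of_int ((m(u := t)) i) * v i j) - q j \<in> \<int>"
      unfolding sum_upd using tm unfolding C_def by (auto simp: algebra_simps)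
    ultimately show ?case using tm by simp
  next
    case (3 tm)
    then show ?case using u unfolding C_def by (auto simp: PiE_def extensional_def fun_eq_iff)
  next
    case (5 m)
    then show ?case using prod_upd[of "m(u := undefined)" "m u"] by simp
  qed auto
  also have "\<dots> = (\<Sum>t\<in>{-int L..int L}. lazy_walk l L t * (\<Sum>m\<in>C t. walk_weight U m))"
    using finC by (subst sum.Sigma[symmetric]) (auto simp: sum_distrib_left)
  also have "\<dots> = (\<Sum>t\<in>T. lazy_walk l L t * (\<Sum>m\<in>C t. walk_weight U m))"
    unfolding T_def by (intro sum.mono_neutral_right) auto
  also have "\<dots> \<le> (\<Sum>t\<in>T. lazy_walk l L t * w)"
    using w l unfolding C_def by (intro sum_mono mult_left_mono lazy_walk_nonneg) auto
  also have "\<dots> = (\<Sum>t\<in>T. lazy_walk l L t) * w" by (simp add: sum_distrib_right)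
  also have "\<dots> \<le> (1 / d + 2 * lazy_walk l L 0) * w"
  proof (intro mult_right_mono w0 lazy_walk_residue)
    fix t t' assume "t \<in> T" "t' \<in> T"
    then obtain m m' where m: "m \<in> C t" "m' \<in> C t'" unfolding T_def by auto
    \<comment> \<open>Multiplication by \<open>D\<close> makes the contributions of \<open>U\<close>
      integral, which leaves a congruence for \<open>t\<close> alone.\<close>
    have key: "of_int t * (real D * v u j) - real D * q j \<in> \<int>" if "m \<in> C t" "j \<in> I0" for m t j
    proof -
      have "real D * ((\<Sum>i\<in>U. of_int (m i) * v i j) - (q j - of_int t * v u j)) \<in> \<int>"
        using that unfolding C_def by (intro Ints_mult) auto
      moreover have "(\<Sum>i\<in>U. of_int (m i) * (real D * v i j)) \<in> \<int>"
        using D that by (intro Ints_sum Ints_mult[OF Ints_of_int]) auto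
      ultimately have "real D * ((\<Sum>i\<in>U. of_int (m i) * v i j) - (q j - of_int t * v u j))
          - (\<Sum>i\<in>U. of_int (m i) * (real D * v i j)) \<in> \<int>" by (rule Ints_diff)
      then show ?thesis by (simp add: algebra_simps sum_distrib_left)
    qed
    show "int d dvd t - t'"
    proof (rule ord)
      fix j assume "j \<in> I0"
      then have "(of_int t * (real D * v u j) - real D * q j) - (of_int t' * (real D * v u j) - real D * q j) \<in> \<int>"
        by (intro Ints_diff[OF key[OF m(1)] key[OF m(2)]])
      then show "of_int (t - t') * (real D * v u j) \<in> \<int>" by (simp add: algebra_simps)
    qed
  qed (use l d in \<open>auto simp: T_def\<close>)
  finally show ?thesis .
qed

end

subsection \<open>Common denominators\<close>

text \<open>Each \<open>b i\<close> with \<open>i\<close> in \<open>H\<close> is close to a rational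
  combination, with its own small denominator, of a basis \<open>I0\<close> that is dissociated at a
  larger scale \<kappa>. The assumption \<open>residue\<close> makes a restriction modulo
  \<open>d\<close> gain \<open>d powr (- \<delta>)\<close>; the inequality on \<kappa> leaves room
  for clearing denominators in sums of up to \<open>n\<close> walks.\<close>

locale rational_coordinates = concentrated +
  fixes I0 H :: "nat set" and v :: "nat \<Rightarrow> nat \<Rightarrow> real" and \<kappa> \<kappa>' K \<delta> :: real
  assumes I0: "finite I0" "dissociated \<kappa> I0" and H: "H \<subseteq> {..<n}"
    and denominator: "\<And>i. i \<in> H \<Longrightarrow> \<exists>s::nat. 1 \<le> s \<and> s \<le> \<kappa>' \<and> (\<forall>j\<in>I0. s * v i j \<in> \<int>)"
    and v_le: "\<And>i j. i \<in> H \<Longrightarrow> j \<in> I0 \<Longrightarrow> \<bar>v i j\<bar> \<le> \<kappa>'"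
    and v_approx: "\<And>i. i \<in> H \<Longrightarrow> \<bar>b i - (\<Sum>j\<in>I0. v i j * b j)\<bar> \<le> \<beta> * \<kappa>'"
    and \<delta>: "\<delta> > 0"
    and residue: "\<And>d::nat. 2 \<le> d \<Longrightarrow> d \<le> \<kappa>' \<Longrightarrow> 1 / d + 2 * lazy_walk l L 0 \<le> d powr (- \<delta>)"
    and V: "V > 0" "exp (- (c1 * K)\<^sup>2 / 2) \<le> V / 2" and K: "K > 0"
    and \<kappa>: "((2 / V) powr (1 / \<delta>) * \<kappa>') * (K + n * (L * \<kappa>')) \<le> \<kappa>"
    and \<kappa>'_ge: "\<kappa>' \<ge> 0"
begin

text \<open>The largest denominator compatible with
  \<open>D powr (- \<delta>) >= V / 2\<close>.\<close>

abbreviation Dmax :: real where "Dmax \<equiv> (2 / V) powr (1 / \<delta>)"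

text \<open>Every extension at least doubles \<open>D\<close>, whence the power of 2. The weight
  bound ranges over all targets \<open>q\<close> because \<open>residue_weight_insert\<close> needs
  this to be iterated.\<close>

definition chain :: "nat set \<Rightarrow> nat set \<Rightarrow> nat \<Rightarrow> bool" where
  "chain U X D \<longleftrightarrow> traded U X \<and> U \<subseteq> H \<and> D \<ge> 1 \<and> 2 ^ card U \<le> D \<and>
     (\<forall>i\<in>U. \<forall>j\<in>I0. D * v i j \<in> \<int>) \<and>
     (\<forall>q. (\<Sum>m\<in>{m\<in>box U. \<forall>j\<in>I0. (\<Sum>i\<in>U. of_int (m i) * v i j) - q j \<in> \<int>}. walk_weight U m)
            \<le> D powr (- \<delta>))"

lemma chain_empty: "chain {} {} 1"
proof -
  have "(\<Sum>m\<in>{m\<in>box {}. \<forall>j\<in>I0. (\<Sum>i\<in>{}. of_int (m i) * v i j) - q j \<in> \<int>}. walk_weight {} m) \<le> 1" for q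
  proof -
    have "(\<Sum>m\<in>{m\<in>box {}. \<forall>j\<in>I0. (\<Sum>i\<in>{}. of_int (m i) * v i j) - q j \<in> \<int>}. walk_weight {} m)
      \<le> (\<Sum>m\<in>box {}. walk_weight {} m)" by (intro sum_mono2) auto
    then show ?thesis by simp
  qed
  then show ?thesis unfolding chain_def using traded_empty by simp
qed

text \<open>A short walk along \<open>U\<close> becomes, after replacing each \<open>b i\<close> by
  its combination and multiplying by \<open>D\<close>, an integer relation on \<open>I0\<close>
  within scale \<kappa>, which is trivial by dissociation. The weaker bound on \<open>D\<close>
  admits a denominator that has just been enlarged.\<close>

lemma chain_coordinates_eq_0:
  assumes ch: "chain U X D" and D: "D \<le> Dmax * \<kappa>'"
    and m: "m \<in> box U" "\<bar>\<Sum>i\<in>U. of_int (m i) * b i\<bar> \<le> \<beta> * K" and j: "j \<in> I0"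
  shows "(\<Sum>i\<in>U. of_int (m i) * v i j) = 0"
proof -
  have U: "U \<subseteq> {..<n}" "U \<subseteq> H" "finite U" "D \<ge> 1"
    using ch unfolding chain_def traded_def by (auto intro: finite_subset)
  have cU: "card U \<le> n" using card_mono[OF _ U(1)] by simp
  define s where "s j = (\<Sum>i\<in>U. of_int (m i) * v i j)" for j
  have "real D * s j \<in> \<int>" if "j \<in> I0" for j
  proof -
    have "real D * s j = (\<Sum>i\<in>U. of_int (m i) * (real D * v i j))"
      by (simp add: s_def sum_distrib_left mult_ac)
    also have "\<dots> \<in> \<int>" using ch that unfolding chain_def by (intro Ints_sum Ints_mult[OF Ints_of_int]) auto
    finally show ?thesis .
  qed
  then have N: "real D * s j = of_int \<lfloor>real D * s j\<rfloor>" if "j \<in> I0" for j using that by simp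
  define N where "N j = \<lfloor>real D * s j\<rfloor>" for j
  have N: "real D * s j = of_int (N j)" if "j \<in> I0" for j using N[OF that] by (simp add: N_def)
  have "(\<Sum>i\<in>U. \<bar>of_int (m i)\<bar> * \<kappa>') \<le> (\<Sum>i\<in>U. L * \<kappa>')"
    using box_le[OF m(1)] \<kappa>'_ge by (intro sum_mono mult_right_mono) auto
  also have "\<dots> \<le> n * (L * \<kappa>')"
    using cU \<kappa>'_ge by (simp add: mult_right_mono)
  finally have nLk: "(\<Sum>i\<in>U. \<bar>of_int (m i)\<bar> * \<kappa>') \<le> n * (L * \<kappa>')" .
  have nn: "0 \<le> n * (L * \<kappa>')" using \<kappa>'_ge by simp
  have big: "D * (K + n * (L * \<kappa>')) \<le> \<kappa>"
    by (rule order_trans[OF _ \<kappa>]) (use D K nn in \<open>intro mult_right_mono, auto\<close>)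
  have "\<bar>s j\<bar> \<le> n * (L * \<kappa>')" if "j \<in> I0" for j
  proof -
    have "\<bar>s j\<bar> \<le> (\<Sum>i\<in>U. \<bar>of_int (m i) * v i j\<bar>)" unfolding s_def by (rule sum_abs)
    also have "\<dots> \<le> (\<Sum>i\<in>U. \<bar>of_int (m i)\<bar> * \<kappa>')"
      using v_le that U by (intro sum_mono) (auto simp: abs_mult intro!: mult_left_mono)
    finally show ?thesis using nLk by linarith
  qed
  then have sK: "\<bar>s j\<bar> \<le> K + n * (L * \<kappa>')" if "j \<in> I0" for j using that K by force
  have N_le: "\<bar>of_int (N j)\<bar> \<le> \<kappa>" if "j \<in> I0" for j
  proof -
    have "\<bar>D * s j\<bar> \<le> D * (K + n * (L * \<kappa>'))"
      unfolding abs_mult using sK[OF that] by (intro mult_mono) auto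
    then show ?thesis using N[OF that] big by linarith
  qed
  have "(\<Sum>j\<in>I0. of_int (N j) * b j) = (\<Sum>j\<in>I0. real D * s j * b j)"
    using N by (intro sum.cong) auto
  also have "\<dots> = D * (\<Sum>j\<in>I0. \<Sum>i\<in>U. of_int (m i) * (v i j * b j))"
    by (simp add: s_def sum_distrib_left sum_distrib_right mult_ac)
  also have "\<dots> = D * (\<Sum>i\<in>U. of_int (m i) * (\<Sum>j\<in>I0. v i j * b j))"
    by (subst sum.swap) (simp add: sum_distrib_left)
  also have "\<dots> = D * ((\<Sum>i\<in>U. of_int (m i) * b i) - (\<Sum>i\<in>U. of_int (m i) * (b i - (\<Sum>j\<in>I0. v i j * b j))))"
    by (simp add: right_diff_distrib sum_subtractf)
  finally have Nb: "(\<Sum>j\<in>I0. of_int (N j) * b j) = \<dots>" .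
  have "\<bar>\<Sum>i\<in>U. of_int (m i) * (b i - (\<Sum>j\<in>I0. v i j * b j))\<bar> \<le> (\<Sum>i\<in>U. \<bar>of_int (m i)\<bar> * (\<beta> * \<kappa>'))"
    by (rule order_trans[OF sum_abs]) (use v_approx U in \<open>auto simp: abs_mult intro!: sum_mono mult_left_mono\<close>)
  also have "\<dots> = \<beta> * (\<Sum>i\<in>U. \<bar>of_int (m i)\<bar> * \<kappa>')" by (simp add: sum_distrib_left mult_ac)
  also have "\<dots> \<le> \<beta> * (n * (L * \<kappa>'))" using nLk \<beta> by (intro mult_left_mono) auto
  finally have "\<bar>(\<Sum>i\<in>U. of_int (m i) * b i) - (\<Sum>i\<in>U. of_int (m i) * (b i - (\<Sum>j\<in>I0. v i j * b j)))\<bar>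
     \<le> \<beta> * (K + n * (L * \<kappa>'))" using m(2) by (simp only: distrib_left)
  then have "\<bar>\<Sum>j\<in>I0. of_int (N j) * b j\<bar> \<le> D * (\<beta> * (K + n * (L * \<kappa>')))"
    unfolding Nb abs_mult by (intro mult_mono) auto
  also have "\<dots> = \<beta> * (D * (K + n * (L * \<kappa>')))" by simp
  also have "\<dots> \<le> \<beta> * \<kappa>" using big \<beta> by (intro mult_left_mono) auto
  finally have "N j = 0" using dissociatedD[OF I0(2), of N] N_le j by blast
  then show ?thesis using N[OF j] U by (simp add: s_def)
qed

text \<open>Walks that end near the origin have vanishing, hence integral, coordinates, so the chain
  bounds their weight by \<open>D powr (- \<delta>)\<close>. The Gaussian tail takes only half of
  \<open>V\<close>; thus the a priori bound on \<open>D\<close> loses its factor \<kappa>'.\<close>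

lemma chain_le:
  assumes ch: "chain U X D" and D: "D \<le> Dmax * \<kappa>'"
  shows "D \<le> Dmax"
proof -
  have tr: "traded U X" and D1: "D \<ge> 1" using ch unfolding chain_def by blast+
  have fin: "finite (box U)"
    using tr unfolding traded_def by (intro finite_PiE) (auto intro: finite_subset)
  have "V \<le> (\<Sum>m\<in>{m\<in>box U. \<bar>\<Sum>j\<in>U. of_int (m j) * b j\<bar> \<le> \<beta> * K}. walk_weight U m) + V / 2"
    using traded_concentration[OF tr K] V by linarith
  also have "(\<Sum>m\<in>{m\<in>box U. \<bar>\<Sum>j\<in>U. of_int (m j) * b j\<bar> \<le> \<beta> * K}. walk_weight U m)
      \<le> (\<Sum>m\<in>{m\<in>box U. \<forall>j\<in>I0. (\<Sum>i\<in>U. of_int (m i) * v i j) - (\<lambda>_. 0) j \<in> \<int>}. walk_weight U m)"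
    using chain_coordinates_eq_0[OF ch D] fin by (intro sum_mono2 walk_weight_nonneg) auto
  also have "\<dots> \<le> D powr (- \<delta>)" using ch unfolding chain_def by (elim conjE allE[of _ "\<lambda>_. 0"])
  finally have "V / 2 \<le> D powr (- \<delta>)" by simp
  then have "V / 2 \<le> 1 / D powr \<delta>" by (simp add: powr_minus_divide)
  moreover have "D powr \<delta> > 0" using D1 by simp
  ultimately have "D powr \<delta> \<le> 2 / V" using V(1) by (simp add: field_simps)
  then have "(D powr \<delta>) powr (1 / \<delta>) \<le> Dmax" using \<delta> by (intro powr_mono2) auto
  then show ?thesis using \<delta> D1 by (simp add: powr_powr)
qed

text \<open>Among \<open>L\<close> indices with coordinates outside the lattice of denominator
  \<open>D\<close>, one can be traded. The order \<open>d\<close> of its coordinate vector modulo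
  that lattice is at least 2, and \<open>D * d\<close> serves the enlarged family.\<close>

lemma chain_step:
  assumes ch: "chain U X D" and D: "D \<le> Dmax"
    and S: "card {i\<in>H - X. \<not> (\<forall>j\<in>I0. D * v i j \<in> \<int>)} \<ge> L"
  shows "\<exists>U' X' D'. chain U' X' D' \<and> D < D' \<and> D' \<le> Dmax"
proof -
  let ?S = "{i\<in>H - X. \<not> (\<forall>j\<in>I0. D * v i j \<in> \<int>)}"
  have tr: "traded U X" and D1: "D \<ge> 1" and UH: "U \<subseteq> H" using ch unfolding chain_def by blast+
  obtain u X' where u: "u \<in> ?S" "traded (insert u U) X'"
    using traded_step[OF tr, of ?S] S H by blast
  have uH: "u \<in> H" "u \<notin> U" and fin: "finite U" using u tr unfolding traded_def by (auto intro: finite_subset)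
  define P where "P s \<longleftrightarrow> s \<ge> 1 \<and> (\<forall>j\<in>I0. real s * (D * v u j) \<in> \<int>)" for s :: nat
  obtain s :: nat where s: "1 \<le> s" "s \<le> \<kappa>'" "\<forall>j\<in>I0. s * v u j \<in> \<int>" using denominator[OF uH(1)] by blast
  have Ps: "P s" unfolding P_def
  proof (intro conjI ballI s)
    fix j assume "j \<in> I0"
    then have "of_nat D * (real s * v u j) \<in> \<int>" using s by (blast intro: Ints_mult[OF Ints_of_nat])
    then show "real s * (real D * v u j) \<in> \<int>" by (simp add: mult_ac)
  qed
  define d where "d = (LEAST s. P s)"
  have Pd: "P d" unfolding d_def using Ps by (rule LeastI)
  have ds: "d \<le> s" unfolding d_def using Ps by (rule Least_le)
  have "d \<noteq> 1"
  proof
    assume "d = 1"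
    then have "\<forall>j\<in>I0. D * v u j \<in> \<int>" using Pd unfolding P_def by simp
    then show False using u(1) by blast
  qed
  then have d2: "d \<ge> 2" using Pd unfolding P_def by linarith
  have ord: "int d dvd t" if t: "\<And>j. j \<in> I0 \<Longrightarrow> of_int t * (real D * v u j) \<in> \<int>" for t :: int
  proof (rule ccontr)
    \<comment> \<open>The remainder of \<open>t\<close> modulo \<open>d\<close> would be a smaller
      positive multiplier with property \<open>P\<close>.\<close>
    assume "\<not> int d dvd t"
    then have "t mod int d \<noteq> 0" by (simp add: dvd_eq_mod_eq_0)
    moreover have "0 \<le> t mod int d" "t mod int d < int d" using d2 by simp_all
    ultimately have r: "0 < t mod int d" "t mod int d < int d" by linarith+
    have "P (nat (t mod int d))" unfolding P_def
    proof (intro conjI ballI)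
      fix j assume j: "j \<in> I0"
      have "of_int t * (real D * v u j) - of_int (t div int d) * (real d * (real D * v u j)) \<in> \<int>"
        using t[OF j] Pd j unfolding P_def by (blast intro: Ints_diff Ints_mult[OF Ints_of_int])
      also have "of_int t * (real D * v u j) - of_int (t div int d) * (real d * (real D * v u j))
          = of_int (t - t div int d * int d) * (real D * v u j)" by (simp add: algebra_simps)
      also have "t - t div int d * int d = t mod int d" by (simp add: minus_div_mult_eq_mod)
      also have "of_int (t mod int d) = real (nat (t mod int d))" using r by simp
      finally show "real (nat (t mod int d)) * (real D * v u j) \<in> \<int>" .
    qed (use r in linarith)
    then have "d \<le> nat (t mod int d)" unfolding d_def by (rule Least_le)
    then show False using r by linarith
  qed
  have pow: "2 ^ card (insert u U) \<le> D * d"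
  proof -
    have "2 ^ card U * 2 \<le> D * d" using ch d2 unfolding chain_def by (intro mult_mono) auto
    then show ?thesis using uH fin by simp
  qed
  have ints: "real (D * d) * v i j \<in> \<int>" if "i \<in> insert u U" "j \<in> I0" for i j
  proof (cases "i = u")
    case True
    then show ?thesis using Pd that unfolding P_def by (simp add: mult_ac)
  next
    case False
    then have "of_nat d * (real D * v i j) \<in> \<int>" using ch that unfolding chain_def by (blast intro: Ints_mult[OF Ints_of_nat])
    then show ?thesis by (simp add: mult_ac)
  qed
  have weight: "(\<Sum>m\<in>{m\<in>box (insert u U). \<forall>j\<in>I0. (\<Sum>i\<in>insert u U. of_int (m i) * v i j) - q j \<in> \<int>}.
      walk_weight (insert u U) m) \<le> real (D * d) powr (- \<delta>)" for q
  proof -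
    have "(\<Sum>m\<in>{m\<in>box (insert u U). \<forall>j\<in>I0. (\<Sum>i\<in>insert u U. of_int (m i) * v i j) - q j \<in> \<int>}.
      walk_weight (insert u U) m) \<le> (1 / d + 2 * lazy_walk l L 0) * D powr (- \<delta>)"
    proof (intro residue_weight_insert[where D = D] fin uH ord)
      show "0 < d" using d2 by simp
      show "real D * v i j \<in> \<int>" if "i \<in> U" "j \<in> I0" for i j using ch that unfolding chain_def by blast
      show "(\<Sum>m\<in>{m\<in>box U. \<forall>j\<in>I0. (\<Sum>i\<in>U. of_int (m i) * v i j) - q j \<in> \<int>}. walk_weight U m)
            \<le> D powr (- \<delta>)" for q using ch unfolding chain_def by blast
    qed
    also have "\<dots> \<le> d powr (- \<delta>) * D powr (- \<delta>)"
      using d2 ds s(2) by (intro mult_right_mono residue) auto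
    also have "\<dots> = real (D * d) powr (- \<delta>)" by (simp add: powr_mult)
    finally show ?thesis .
  qed
  have ch': "chain (insert u U) X' (D * d)"
    unfolding chain_def
  proof (intro conjI allI ballI)
    show "1 \<le> D * d" using D1 d2 by simp
  qed (use u(2) uH UH pow ints weight in blast)+
  \<comment> \<open>At first only the weaker bound is known; \<open>chain_le\<close> then improves
    it, so the growth can continue.\<close>
  have "real (D * d) \<le> Dmax * \<kappa>'" unfolding of_nat_mult
    using D ds s(2) by (intro mult_mono) auto
  then have "real (D * d) \<le> Dmax" using chain_le[OF ch'] by simp
  moreover have "D < D * d" using D1 d2 by simp
  ultimately show ?thesis using ch' by blast
qed

text \<open>A chain with maximal \<open>D\<close> cannot be extended, so fewer than \<open>L\<close>
  bad indices lie outside \<open>X\<close>. The spent ones number at most \<open>L * card U\<close>,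
  and \<open>card U\<close> is at most \<open>log 2 D\<close> by doubling.\<close>

lemma common_denominator:
  "\<exists>D::nat. 1 \<le> D \<and> D \<le> Dmax \<and> card {i\<in>H. \<not> (\<forall>j\<in>I0. D * v i j \<in> \<int>)} \<le> L * (log 2 D + 1)"
proof -
  define Q where "Q D \<longleftrightarrow> (\<exists>U X. chain U X D) \<and> D \<le> Dmax" for D :: nat
  \<comment> \<open>The integrand is at most 1, hence so is \<open>V\<close>; this admits the
    starting denominator 1.\<close>
  have V1: "1 \<le> Dmax"
  proof -
    have "V \<le> (LINT g|std_normal_distribution. profile {} ({..<n} - {}) g)"
      using traded_empty by (simp add: traded_def)
    also have "\<dots> \<le> (LINT g|std_normal_distribution. 1)"
      by (intro integral_mono integrable_profile profile_bounds) simp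
    finally have "V \<le> 1" using std_normal.prob_space by simp
    then show ?thesis using V \<delta> by (intro ge_one_powr_ge_zero) auto
  qed
  then have "Q 1" unfolding Q_def using chain_empty by auto
  moreover have "\<forall>D. Q D \<longrightarrow> D < Suc (nat \<lceil>Dmax\<rceil>)" unfolding Q_def by linarith
  ultimately obtain D where D: "Q D" "\<And>D'. Q D' \<Longrightarrow> D' \<le> D"
    using ex_has_greatest_nat[of Q 1 "\<lambda>x. x" "Suc (nat \<lceil>Dmax\<rceil>)"] by metis
  then obtain U X where ch: "chain U X D" and Dm: "D \<le> Dmax" unfolding Q_def by blast
  have tr: "traded U X" and D1: "D \<ge> 1" and UH: "U \<subseteq> H" and pow: "2 ^ card U \<le> D"
    using ch unfolding chain_def by blast+
  have X: "card X \<le> L * card U" "finite X" using tr unfolding traded_def by (auto intro: finite_subset)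
  let ?S = "{i\<in>H - X. \<not> (\<forall>j\<in>I0. D * v i j \<in> \<int>)}"
  have "card ?S < L"
  proof (rule ccontr)
    assume "\<not> ?thesis"
    then have "L \<le> card ?S" by simp
    then obtain U' X' D' where "chain U' X' D'" "D < D'" "D' \<le> Dmax"
      using chain_step[OF ch Dm] by blast
    then have "Q D'" "D < D'" unfolding Q_def by blast+
    then show False using D(2)[of D'] by simp
  qed
  moreover have "card {i\<in>H. \<not> (\<forall>j\<in>I0. D * v i j \<in> \<int>)} \<le> card (?S \<union> X)"
    using X finite_subset[OF H] by (intro card_mono) auto
  ultimately have "card {i\<in>H. \<not> (\<forall>j\<in>I0. D * v i j \<in> \<int>)} \<le> L * (card U + 1)"
    using card_Un_le[of ?S X] X by simp
  moreover have "card U \<le> log 2 D"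
  proof -
    have "real (2 ^ card U) \<le> real D" using pow by (subst of_nat_le_iff)
    then show ?thesis using D1 by (intro le_log_of_power) auto
  qed
  then have "L * (card U + 1) \<le> L * (log 2 D + 1)" unfolding of_nat_mult by (intro mult_left_mono) auto
  moreover have "real (card {i\<in>H. \<not> (\<forall>j\<in>I0. D * v i j \<in> \<int>)}) \<le> real (L * (card U + 1))"
    using calculation(1) by (rule of_nat_mono)
  ultimately have "card {i\<in>H. \<not> (\<forall>j\<in>I0. D * v i j \<in> \<int>)} \<le> L * (log 2 D + 1)" by linarith
  then show ?thesis using D1 Dm by blast
qed

end

subsection \<open>The linear inverse theorem\<close>

text \<open>The multiplier \<open>D\<close> is a parameter and not part of the existential, because
  one \<open>D\<close> has to serve all rows.\<close>

definition integer_related :: "(nat \<Rightarrow> real) \<Rightarrow> real \<Rightarrow> nat set \<Rightarrow> real \<Rightarrow> nat \<Rightarrow> nat \<Rightarrow> bool" where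
  "integer_related b \<beta> I0 M D i \<longleftrightarrow> (\<exists>k::nat \<Rightarrow> int. (\<forall>j\<in>I0. \<bar>real_of_int (k j)\<bar> \<le> M) \<and>
     \<bar>D * b i + (\<Sum>j\<in>I0. of_int (k j) * b j)\<bar> \<le> \<beta> * M)"

text \<open>For \<open>t >= 2\<close> the term \<open>1 / t\<close> takes at most three quarters of
  the right-hand side, since \<open>2 powr (1 - \<delta>) >= sqrt 2 >= 4/3\<close>. The exponent
  \<delta> is so small that even at \<open>t = x powr \<Gamma>\<close> the remaining quarter covers
  \<open>2 * p\<close>.\<close>

lemma residue_bound:
  fixes \<delta> \<eta> \<Gamma> e p x :: real and t :: nat
  assumes \<delta>: "\<delta> = \<eta> / \<Gamma>" and \<Gamma>: "\<Gamma> \<ge> 1" and \<eta>: "0 < \<eta>" "\<eta> \<le> 1/2" "\<eta> \<le> e"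
    and x: "x \<ge> 1" and p: "8 * p \<le> x powr (- e)" and t: "2 \<le> t" "t \<le> x powr \<Gamma>"
  shows "1 / t + 2 * p \<le> t powr (- \<delta>)"
proof -
  have \<delta>0: "0 < \<delta>" "\<delta> \<le> 1/2" using \<Gamma> \<eta> by (auto simp: \<delta> field_simps)
  have "x powr (- e) \<le> x powr (- \<eta>)" using x \<eta> by (intro powr_mono) auto
  also have "\<dots> = (x powr \<Gamma>) powr (- \<delta>)" using \<Gamma> by (simp add: powr_powr \<delta>)
  also have "\<dots> \<le> t powr (- \<delta>)" using t \<delta>0 by (intro powr_mono2') auto
  finally have 1: "2 * p \<le> t powr (- \<delta>) / 4" using p by simp
  have "(4/3 :: real) \<le> sqrt 2" by (rule real_le_rsqrt) (simp add: power2_eq_square)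
  also have "\<dots> = 2 powr (1/2)" by (simp add: powr_half_sqrt)
  also have "\<dots> \<le> 2 powr (1 - \<delta>)" using \<delta>0 by (intro powr_mono) auto
  also have "\<dots> \<le> t powr (1 - \<delta>)" using t \<delta>0 by (intro powr_mono2) auto
  also have "\<dots> = t * t powr (- \<delta>)" using t by (simp add: powr_diff powr_minus_divide)
  finally have "1 / t \<le> 3/4 * t powr (- \<delta>)" using t by (simp add: field_simps)
  then show ?thesis using 1 by linarith
qed

text \<open>The coefficient of \<open>b i\<close> in the relation is nonzero, as otherwise the
  relation would live on the dissociated set \<open>I0\<close>; dividing by it gives the
  coordinates.\<close>

lemma (in concentrated) integer_relation_rational:
  assumes indep: "dissociated \<kappa> I0" "finite I0" "i \<notin> I0" and dep: "\<not> dissociated \<kappa>' (insert i I0)"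
    and le: "\<kappa>' \<le> \<kappa>" and \<kappa>': "\<kappa>' \<ge> 0"
  shows "\<exists>v. (\<exists>s::nat. 1 \<le> s \<and> s \<le> \<kappa>' \<and> (\<forall>j\<in>I0. s * v j \<in> \<int>)) \<and> (\<forall>j\<in>I0. \<bar>v j\<bar> \<le> \<kappa>') \<and>
     \<bar>b i - (\<Sum>j\<in>I0. v j * b j)\<bar> \<le> \<beta> * \<kappa>'"
proof -
  obtain m :: "nat \<Rightarrow> int" where m: "\<And>j. j \<in> insert i I0 \<Longrightarrow> \<bar>real_of_int (m j)\<bar> \<le> \<kappa>'"
    "\<bar>\<Sum>j\<in>insert i I0. of_int (m j) * b j\<bar> \<le> \<beta> * \<kappa>'" "\<exists>j\<in>insert i I0. m j \<noteq> 0"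
    using dep unfolding dissociated_def by blast
  have S: "\<bar>of_int (m i) * b i + (\<Sum>j\<in>I0. of_int (m j) * b j)\<bar> \<le> \<beta> * \<kappa>'"
    using m(2) indep by simp
  have mi: "m i \<noteq> 0"
  proof
    assume 0: "m i = 0"
    have "\<bar>\<Sum>j\<in>I0. of_int (m j) * b j\<bar> \<le> \<beta> * \<kappa>'" using S 0 by simp
    then have "m j = 0" if "j \<in> I0" for j
      using dissociatedD[OF dissociated_mono[OF indep(1) le], of m j] m(1) that by blast
    then show False using m(3) 0 by blast
  qed
  have mi1: "\<bar>real_of_int (m i)\<bar> \<ge> 1" using mi by linarith
  define v where "v j = - of_int (m j) / real_of_int (m i)" for j
  have abs: "\<bar>x / real_of_int (m i)\<bar> \<le> \<bar>x\<bar>" for x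
    using mi1 mult_left_mono[OF mi1, of "\<bar>x\<bar>"] by (simp add: abs_divide divide_le_eq)
  have "1 \<le> real (nat \<bar>m i\<bar>)" "nat \<bar>m i\<bar> \<le> \<kappa>'" using mi1 m(1)[of i] by auto
  moreover have "nat \<bar>m i\<bar> * v j \<in> \<int>" for j
  proof -
    have "nat \<bar>m i\<bar> * v j = of_int (- sgn (m i) * m j)" using mi by (simp add: v_def sgn_if)
    then show ?thesis by simp
  qed
  moreover have "\<bar>v j\<bar> \<le> \<kappa>'" if "j \<in> I0" for j
    using abs[of "- of_int (m j)"] m(1)[of j] that unfolding v_def by simp
  moreover have "\<bar>b i - (\<Sum>j\<in>I0. v j * b j)\<bar> \<le> \<beta> * \<kappa>'"
  proof -
    have "b i - (\<Sum>j\<in>I0. v j * b j) = (of_int (m i) * b i + (\<Sum>j\<in>I0. of_int (m j) * b j)) / of_int (m i)"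
      using mi by (simp add: v_def add_divide_distrib sum_divide_distrib sum_negf)
    then show ?thesis
      using S abs[of "of_int (m i) * b i + (\<Sum>j\<in>I0. of_int (m j) * b j)"] by linarith
  qed
  ultimately show ?thesis by blast
qed

text \<open>A maximal dissociated family provides the basis, and \<open>common_denominator\<close>
  one multiplier for nearly all dependent indices; both exceptional sets are multiples of
  \<open>L\<close> up to a logarithm.\<close>

lemma (in concentrated) integer_relations:
  fixes B e \<eta> Q :: real and d :: nat
  assumes n: "n \<ge> 9" "L \<le> n" and B: "B \<ge> 0"
    and V: "V = n powr (- B) / 4" "exp (- (c1 * n)\<^sup>2 / 2) \<le> V / 2"
    and p: "8 * lazy_walk l L 0 \<le> n powr (- e)"
    and \<eta>: "0 < \<eta>" "\<eta> \<le> 1/2" "\<eta> \<le> e"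
    and d: "e * d \<ge> B + 1" and Q: "Q = (B + 1) / \<eta> + 5"
  shows "\<exists>I0 (D::nat). I0 \<subseteq> {..<n} \<and> card I0 < d \<and> 1 \<le> D \<and> D \<le> n powr (Q ^ d) \<and>
     card {i\<in>{..<n} - I0. \<not> integer_related b \<beta> I0 (n powr (Q ^ d)) D i}
      \<le> L * (d + 2 + Q ^ d * log 2 n)"
proof -
  have Q1: "Q \<ge> 1" using \<eta> B by (simp add: Q)
  have n1: "real n \<ge> 1" "real n > 0" using n by auto
  have V0: "V > 0" using n by (simp add: V)
  \<comment> \<open>Each scale is the \<open>Q\<close>-th power of the next, so independence of the
    basis is known at a scale far above that of the dependences on it.\<close>
  define \<kappa> where "\<kappa> r = real n powr (Q ^ (d - r))" for r
  have \<kappa>n: "real n \<le> \<kappa> r" for r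
  proof -
    have "real n powr 1 \<le> \<kappa> r" unfolding \<kappa>_def using n Q1 by (intro powr_mono one_le_power) auto
    then show ?thesis using n by simp
  qed
  \<comment> \<open>The choice of \<open>d\<close> makes \<open>d\<close> return probabilities gain
    one power of \<open>n\<close> over \<open>n powr (- B)\<close>; with \<open>n >= 9\<close> that
    is less than \<open>V / 2\<close>.\<close>
  have pd: "lazy_walk l L 0 ^ d \<le> n powr (- B - 1)"
  proof -
    have "0 \<le> lazy_walk l L 0" using l by (intro lazy_walk_nonneg) auto
    then have "lazy_walk l L 0 ^ d \<le> (n powr (- e)) ^ d" using p by (intro power_mono) auto
    also have "\<dots> = n powr (- (e * d))" using n by (simp add: powr_realpow[symmetric] powr_powr)
    also have "\<dots> \<le> n powr (- B - 1)" using d n by (intro powr_mono) auto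
    finally show ?thesis .
  qed
  also have "\<dots> = n powr (- B) / n" using n by (simp add: powr_diff)
  also have "\<dots> < V / 2" using n V0 by (simp add: V field_simps)
  finally have "lazy_walk l L 0 ^ d + exp (- (c1 * n)\<^sup>2 / 2) < V" using V(2) by linarith
  moreover have "real L \<le> \<kappa> r" for r using \<kappa>n[of r] n by linarith
  ultimately obtain I0 where basis: "I0 \<subseteq> {..<n}" "card I0 < d" "dissociated (\<kappa> (card I0)) I0"
    and few: "card {i\<in>{..<n} - I0. dissociated (\<kappa> (Suc (card I0))) (insert i I0)} \<le> L * (d + 1)"
    using maximal_dissociated[of d n \<kappa>] \<kappa>n n by auto
  define \<Gamma> where "\<Gamma> = Q ^ (d - Suc (card I0))"
  have \<Gamma>1: "\<Gamma> \<ge> 1" unfolding \<Gamma>_def using Q1 by (rule one_le_power)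
  have "Q * \<Gamma> = Q ^ (d - card I0)" using basis(2) unfolding \<Gamma>_def by (simp add: power_Suc[symmetric] Suc_diff_Suc)
  then have Q\<Gamma>: "Q * \<Gamma> \<le> Q ^ d" "\<kappa> (card I0) = n powr (Q * \<Gamma>)"
    using Q1 by (auto simp: \<kappa>_def intro: power_increasing)
  define \<kappa>' where "\<kappa>' = real n powr \<Gamma>"
  have \<kappa>': "\<kappa> (Suc (card I0)) = \<kappa>'" by (simp add: \<kappa>_def \<kappa>'_def \<Gamma>_def)
  have \<kappa>'1: "\<kappa>' \<ge> 1" using \<kappa>n[of "Suc (card I0)"] n unfolding \<kappa>' by simp
  have \<Gamma>Q: "\<Gamma> \<le> Q * \<Gamma>" using mult_right_mono[OF Q1, of \<Gamma>] \<Gamma>1 by simp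
  have \<kappa>\<kappa>': "\<kappa>' \<le> \<kappa> (card I0)" unfolding Q\<Gamma>(2) \<kappa>'_def using n \<Gamma>Q by (intro powr_mono) auto
  have fin: "finite I0" using basis finite_subset by blast
  define H where "H = {i\<in>{..<n} - I0. \<not> dissociated \<kappa>' (insert i I0)}"
  have "\<forall>i\<in>H. \<exists>v. (\<exists>s::nat. 1 \<le> s \<and> s \<le> \<kappa>' \<and> (\<forall>j\<in>I0. s * v j \<in> \<int>)) \<and> (\<forall>j\<in>I0. \<bar>v j\<bar> \<le> \<kappa>') \<and>
     \<bar>b i - (\<Sum>j\<in>I0. v j * b j)\<bar> \<le> \<beta> * \<kappa>'"
    using integer_relation_rational[OF basis(3) fin _ _ \<kappa>\<kappa>'] \<kappa>'1 unfolding H_def by auto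
  then obtain v where v: "\<And>i. i \<in> H \<Longrightarrow> (\<exists>s::nat. 1 \<le> s \<and> s \<le> \<kappa>' \<and> (\<forall>j\<in>I0. s * v i j \<in> \<int>))"
     "\<And>i j. i \<in> H \<Longrightarrow> j \<in> I0 \<Longrightarrow> \<bar>v i j\<bar> \<le> \<kappa>'"
     "\<And>i. i \<in> H \<Longrightarrow> \<bar>b i - (\<Sum>j\<in>I0. v i j * b j)\<bar> \<le> \<beta> * \<kappa>'"
    by (subst (asm) bchoice_iff) blast
  \<comment> \<open>Single denominators may reach \<open>n powr \<Gamma>\<close>, while the return
    probability is only known to be of order \<open>n powr (- e)\<close>; the gain exponent
    therefore shrinks with \<Gamma>.\<close>
  define \<delta> where "\<delta> = \<eta> / \<Gamma>"
  have \<delta>: "\<delta> > 0" using \<eta> \<Gamma>1 by (simp add: \<delta>_def)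
  have Dmax: "(2 / V) powr (1 / \<delta>) \<le> n powr ((B + 1) * \<Gamma> / \<eta>)"
  proof -
    have "2 / V = 8 * n powr B" using n by (simp add: V powr_minus field_simps)
    also have "\<dots> \<le> n * n powr B" using n by (intro mult_right_mono) auto
    also have "\<dots> = n powr (B + 1)" using n by (simp add: powr_add)
    finally have "(2 / V) powr (1 / \<delta>) \<le> (n powr (B + 1)) powr (1 / \<delta>)"
      using V0 \<delta> by (intro powr_mono2) auto
    then show ?thesis by (simp add: powr_powr \<delta>_def)
  qed
  \<comment> \<open>The summand 5 in \<open>Q\<close> pays for \<open>2 * \<Gamma> + 3\<close>, as
    \<Gamma> is at least 1.\<close>
  have exponent: "(B + 1) * \<Gamma> / \<eta> + 2 * \<Gamma> + 3 \<le> Q * \<Gamma>"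
    using \<Gamma>1 by (simp add: Q algebra_simps)
  have bound: "((2 / V) powr (1 / \<delta>) * \<kappa>') * (n + n * (L * \<kappa>')) \<le> \<kappa> (card I0)"
  proof -
    have "n * 1 \<le> n * (n * \<kappa>')" "n * (L * \<kappa>') \<le> n * (n * \<kappa>')"
      using n \<kappa>'1 mult_mono[of 1 "real n" 1 \<kappa>'] by (auto intro!: mult_left_mono mult_right_mono)
    then have "n + n * (L * \<kappa>') \<le> 2 * (n * (n * \<kappa>'))" by linarith
    also have "\<dots> \<le> n * (n * (n * \<kappa>'))" using n \<kappa>'1 by (intro mult_right_mono) auto
    also have "\<dots> = n powr (3 + \<Gamma>)"
      using n by (simp add: \<kappa>'_def powr_add numeral_3_eq_3 power_Suc powr_realpow[of n 3, simplified])
    finally have "((2 / V) powr (1 / \<delta>) * \<kappa>') * (n + n * (L * \<kappa>'))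
       \<le> (n powr ((B + 1) * \<Gamma> / \<eta>) * n powr \<Gamma>) * n powr (3 + \<Gamma>)"
      unfolding \<kappa>'_def using Dmax by (intro mult_mono) auto
    also have "\<dots> = n powr ((B + 1) * \<Gamma> / \<eta> + 2 * \<Gamma> + 3)"
      by (simp add: powr_add[symmetric] algebra_simps)
    also have "\<dots> \<le> \<kappa> (card I0)" unfolding Q\<Gamma>(2) using exponent n by (intro powr_mono) auto
    finally show ?thesis .
  qed
  interpret rational_coordinates n L b z \<beta> c1 l V I0 H v "\<kappa> (card I0)" \<kappa>' n \<delta>
  proof
    show "1 / t + 2 * lazy_walk l L 0 \<le> t powr (- \<delta>)" if "2 \<le> t" "t \<le> \<kappa>'" for t :: nat
      using residue_bound[OF \<delta>_def \<Gamma>1 \<eta> _ p that(1)] that(2) n1 unfolding \<kappa>'_def by simp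
  qed (use fin basis v \<delta> V V0 n bound \<kappa>'1 in \<open>auto simp: H_def\<close>)
  obtain D :: nat where D: "1 \<le> D" "D \<le> Dmax"
    "card {i\<in>H. \<not> (\<forall>j\<in>I0. D * v i j \<in> \<int>)} \<le> L * (log 2 D + 1)"
    using common_denominator by blast
  have D_le: "D \<le> n powr ((B + 1) * \<Gamma> / \<eta>)" using D(2) Dmax by linarith
  have "0 \<le> (B + 1) * \<Gamma> / \<eta>" using B \<Gamma>1 \<eta> by simp
  then have ex2: "(B + 1) * \<Gamma> / \<eta> \<le> Q ^ d" "(B + 1) * \<Gamma> / \<eta> + \<Gamma> \<le> Q ^ d"
    using exponent Q\<Gamma>(1) \<Gamma>1 by linarith+
  have DQ: "D \<le> n powr (Q ^ d)"
    by (rule order_trans[OF D_le]) (use ex2 n in \<open>intro powr_mono, auto\<close>)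
  have D\<kappa>': "D * \<kappa>' \<le> n powr (Q ^ d)"
  proof -
    have "D * \<kappa>' \<le> n powr ((B + 1) * \<Gamma> / \<eta>) * n powr \<Gamma>"
      unfolding \<kappa>'_def using D_le by (intro mult_right_mono) auto
    also have "\<dots> \<le> n powr (Q ^ d)" unfolding powr_add[symmetric] using ex2 n by (intro powr_mono) auto
    finally show ?thesis .
  qed
  have good: "integer_related b \<beta> I0 (n powr (Q ^ d)) D i"
    if i: "i \<in> H" "\<forall>j\<in>I0. D * v i j \<in> \<int>" for i
  proof -
    define k where "k j = - \<lfloor>D * v i j\<rfloor>" for j
    have k: "real_of_int (k j) = - (D * v i j)" if "j \<in> I0" for j
      using i(2) that by (simp add: k_def)
    have "\<bar>real_of_int (k j)\<bar> \<le> n powr (Q ^ d)" if "j \<in> I0" for j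
    proof -
      have "\<bar>real_of_int (k j)\<bar> = D * \<bar>v i j\<bar>" using k[OF that] by (simp add: abs_mult)
      also have "\<dots> \<le> D * \<kappa>'" using v(2)[OF i(1) that] by (intro mult_left_mono) auto
      finally show ?thesis using D\<kappa>' by linarith
    qed
    moreover have "\<bar>D * b i + (\<Sum>j\<in>I0. of_int (k j) * b j)\<bar> \<le> \<beta> * n powr (Q ^ d)"
    proof -
      have "(\<Sum>j\<in>I0. of_int (k j) * b j) = (\<Sum>j\<in>I0. - (D * (v i j * b j)))"
        using k by (intro sum.cong) auto
      then have "D * b i + (\<Sum>j\<in>I0. of_int (k j) * b j) = D * (b i - (\<Sum>j\<in>I0. v i j * b j))"
        by (simp add: sum_negf sum_distrib_left right_diff_distrib)
      then have "\<bar>D * b i + (\<Sum>j\<in>I0. of_int (k j) * b j)\<bar> \<le> D * (\<beta> * \<kappa>')"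
        using v(3)[OF i(1)] by (simp add: abs_mult mult_left_mono)
      also have "\<dots> = \<beta> * (D * \<kappa>')" by simp
      also have "\<dots> \<le> \<beta> * n powr (Q ^ d)" using D\<kappa>' \<beta> by (intro mult_left_mono) auto
      finally show ?thesis .
    qed
    ultimately show ?thesis unfolding integer_related_def by blast
  qed
  let ?A = "{i\<in>{..<n} - I0. dissociated (\<kappa> (Suc (card I0))) (insert i I0)}"
  let ?B = "{i\<in>H. \<not> (\<forall>j\<in>I0. D * v i j \<in> \<int>)}"
  let ?bad = "{i\<in>{..<n} - I0. \<not> integer_related b \<beta> I0 (n powr (Q ^ d)) D i}"
  have "?bad \<subseteq> ?A \<union> ?B" using good unfolding H_def \<kappa>' by blast
  then have "card ?bad \<le> card (?A \<union> ?B)" using H by (intro card_mono) (auto simp: H_def)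
  also have "\<dots> \<le> card ?A + card ?B" by (rule card_Un_le)
  finally have "real (card ?bad) \<le> L * (d + 1) + L * (log 2 D + 1)"
    using few D(3) by (smt (verit) of_nat_add of_nat_le_iff)
  also have "\<dots> \<le> L * (d + 2 + Q ^ d * log 2 n)"
  proof -
    have "log 2 D \<le> log 2 (n powr (Q ^ d))" using DQ D(1) n by (subst log_le_cancel_iff) auto
    also have "\<dots> = Q ^ d * log 2 n" using n by (simp add: log_powr)
    finally have "L * ((d + 1) + (log 2 D + 1)) \<le> L * (d + 2 + Q ^ d * log 2 n)"
      by (intro mult_left_mono) auto
    then show ?thesis by (simp only: distrib_left of_nat_mult of_nat_add)
  qed
  finally show ?thesis by (intro exI[of _ I0] exI[of _ D] conjI basis(1,2) D(1) DQ)
qed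

text \<open>With \<open>L\<close> about \<open>n powr (\<epsilon> / 2)\<close> and
  \<open>V = n powr (- B) / 4\<close>, the conditions put the Gaussian tail below
  \<open>V / 2\<close>, eight times the return probability below
  \<open>n powr (- (\<epsilon> / 8))\<close>, and the exceptional set below
  \<open>n powr \<epsilon>\<close>.\<close>

lemma eventually_parameters:
  fixes \<epsilon> B c1 l c C :: real
  assumes "0 < \<epsilon>" "0 < c1" "0 < l"
  shows "\<forall>\<^sub>F n::nat in sequentially. n \<ge> (9::nat) \<and> exp (- (c1 * n)\<^sup>2 / 2) \<le> n powr (- B) / 8 \<and>
     24 / sqrt (l * n powr (\<epsilon> / 2)) \<le> n powr (- (\<epsilon> / 8)) \<and>
     (n powr (\<epsilon> / 2) + 1) * (c + C * log 2 n) \<le> n powr \<epsilon>"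
proof (intro eventually_conj eventually_ge_at_top)
  have "((\<lambda>n::real. exp (- (c1 * n)\<^sup>2 / 2) * (8 * n powr B)) \<longlongrightarrow> 0) at_top"
    using assms by real_asymp
  then have "\<forall>\<^sub>F n::nat in sequentially. exp (- (c1 * n)\<^sup>2 / 2) * (8 * n powr B) < 1"
    by (intro order_tendstoD filterlim_compose[OF _ filterlim_real_sequentially])
       (auto intro: filterlim_compose[OF _ filterlim_real_sequentially])
  then show "\<forall>\<^sub>F n::nat in sequentially. exp (- (c1 * n)\<^sup>2 / 2) \<le> n powr (- B) / 8"
    using eventually_gt_at_top[of "0::nat"]
  proof eventually_elim
    case (elim n)
    then show ?case by (simp add: powr_minus field_simps)
  qed
  have "((\<lambda>n::real. 24 / sqrt (l * n powr (\<epsilon> / 2)) * n powr (\<epsilon> / 8)) \<longlongrightarrow> 0) at_top"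
    using assms by real_asymp
  then have "\<forall>\<^sub>F n::nat in sequentially. 24 / sqrt (l * n powr (\<epsilon> / 2)) * n powr (\<epsilon> / 8) < 1"
    by (intro order_tendstoD filterlim_compose[OF _ filterlim_real_sequentially])
       (auto intro: filterlim_compose[OF _ filterlim_real_sequentially])
  then show "\<forall>\<^sub>F n::nat in sequentially. 24 / sqrt (l * n powr (\<epsilon> / 2)) \<le> n powr (- (\<epsilon> / 8))"
    using eventually_gt_at_top[of "0::nat"]
  proof eventually_elim
    case (elim n)
    then show ?case by (simp add: powr_minus field_simps)
  qed
  have "((\<lambda>n::real. (n powr (\<epsilon> / 2) + 1) * (c + C * log 2 n) / n powr \<epsilon>) \<longlongrightarrow> 0) at_top"
    using assms by real_asymp
  then have "\<forall>\<^sub>F n::nat in sequentially. (n powr (\<epsilon> / 2) + 1) * (c + C * log 2 n) / n powr \<epsilon> < 1"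
    by (intro order_tendstoD filterlim_compose[OF _ filterlim_real_sequentially])
       (auto intro: filterlim_compose[OF _ filterlim_real_sequentially])
  then show "\<forall>\<^sub>F n::nat in sequentially. (n powr (\<epsilon> / 2) + 1) * (c + C * log 2 n) \<le> n powr \<epsilon>"
    using eventually_gt_at_top[of "0::nat"]
  proof eventually_elim
    case (elim n)
    then show ?case by (simp add: field_simps)
  qed
qed

lemma integer_related_mono:
  assumes "integer_related b \<beta> I0 M D i" "M \<le> M'" "\<beta> * M \<le> \<beta> * M'"
  shows "integer_related b \<beta> I0 M' D i"
  using assms unfolding integer_related_def by (meson order_trans)

text \<open>The witness for \<open>C\<close> is built from \<epsilon> and \<open>B\<close> alone;
  \<open>c1\<close> and \<open>c3\<close> enter only the threshold for \<open>n\<close>. Law, scale,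
  centre and coefficients are quantified after the threshold, so the result applies uniformly to the
  forms obtained from each \<open>y\<close>.\<close>

lemma linear_inverse_littlewood_offord:
  fixes \<epsilon> B c1 c2 c3 :: real
  assumes "0 < \<epsilon>" "\<epsilon> < 1" "0 \<le> B" "0 < c1" "0 < c3"
  shows "\<exists>C::real. C \<ge> 0 \<and> (\<forall>\<^sub>F n in sequentially. \<forall>\<mu> \<beta> a (b::nat \<Rightarrow> real).
    \<beta> > 0 \<longrightarrow> real_distribution \<mu> \<longrightarrow>
    measure (\<mu> \<Otimes>\<^sub>M \<mu>) {p \<in> space (\<mu> \<Otimes>\<^sub>M \<mu>). c1 \<le> \<bar>fst p - snd p\<bar> \<and> \<bar>fst p - snd p\<bar> \<le> c2} \<ge> c3 \<longrightarrow>
    measure (PiM {..<n} (\<lambda>_. \<mu>)) {x \<in> space (PiM {..<n} (\<lambda>_. \<mu>)). \<bar>(\<Sum>i<n. b i * x i) - a\<bar> \<le> \<beta>}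
       \<ge> n powr (- B) \<longrightarrow>
    (\<exists>I0 (D::nat). I0 \<subseteq> {..<n} \<and> card I0 \<le> C \<and> 1 \<le> D \<and> D \<le> n powr C \<and>
       card {i\<in>{..<n} - I0. \<not> integer_related b \<beta> I0 (n powr C) D i} \<le> n powr \<epsilon>))"
proof -
  define l where "l = (1 - exp (- c3)) / 2"
  have l: "0 < l" "l < 1/2" using assms by (auto simp: l_def)
  define e where "e = \<epsilon> / 8"
  define d where "d = nat \<lceil>(B + 1) / e\<rceil>"
  define \<eta> where "\<eta> = min (1/2) e"
  define Q where "Q = (B + 1) / \<eta> + 5"
  define C where "C = d + Q ^ d"
  have e: "e > 0" using assms by (simp add: e_def)
  have \<eta>: "0 < \<eta>" "\<eta> \<le> 1/2" "\<eta> \<le> e" using e by (auto simp: \<eta>_def)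
  have "(B + 1) / e \<le> d" unfolding d_def by (rule real_nat_ceiling_ge)
  then have d: "B + 1 \<le> e * d" using e by (simp add: field_simps)
  have Q1: "Q \<ge> 1" using \<eta> assms by (simp add: Q_def)
  have Qd: "Q ^ d \<ge> 1" using Q1 by (rule one_le_power)
  show ?thesis
  proof (intro exI[of _ C] conjI)
    show "0 \<le> C" using Qd by (simp add: C_def)
    show "\<forall>\<^sub>F n in sequentially. \<forall>\<mu> \<beta> a (b::nat \<Rightarrow> real).
      \<beta> > 0 \<longrightarrow> real_distribution \<mu> \<longrightarrow>
      measure (\<mu> \<Otimes>\<^sub>M \<mu>) {p \<in> space (\<mu> \<Otimes>\<^sub>M \<mu>). c1 \<le> \<bar>fst p - snd p\<bar> \<and> \<bar>fst p - snd p\<bar> \<le> c2} \<ge> c3 \<longrightarrow>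
      measure (PiM {..<n} (\<lambda>_. \<mu>)) {x \<in> space (PiM {..<n} (\<lambda>_. \<mu>)). \<bar>(\<Sum>i<n. b i * x i) - a\<bar> \<le> \<beta>}
         \<ge> n powr (- B) \<longrightarrow>
      (\<exists>I0 (D::nat). I0 \<subseteq> {..<n} \<and> card I0 \<le> C \<and> 1 \<le> D \<and> D \<le> n powr C \<and>
         card {i\<in>{..<n} - I0. \<not> integer_related b \<beta> I0 (n powr C) D i} \<le> n powr \<epsilon>)"
      using eventually_parameters[OF assms(1,4) l(1), of B "d + 2" "Q ^ d"]
    proof (eventually_elim, intro allI impI)
      fix n :: nat and \<mu> :: "real measure" and \<beta> a :: real and b :: "nat \<Rightarrow> real"
      assume n: "n \<ge> 9 \<and> exp (- (c1 * n)\<^sup>2 / 2) \<le> n powr (- B) / 8 \<and>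
         24 / sqrt (l * n powr (\<epsilon> / 2)) \<le> n powr (- (\<epsilon> / 8)) \<and>
         (n powr (\<epsilon> / 2) + 1) * ((d + 2) + Q ^ d * log 2 n) \<le> n powr \<epsilon>"
        and \<beta>: "\<beta> > 0" and \<mu>: "real_distribution \<mu>"
        and c3: "measure (\<mu> \<Otimes>\<^sub>M \<mu>) {p \<in> space (\<mu> \<Otimes>\<^sub>M \<mu>). c1 \<le> \<bar>fst p - snd p\<bar> \<and> \<bar>fst p - snd p\<bar> \<le> c2} \<ge> c3"
        and P: "measure (PiM {..<n} (\<lambda>_. \<mu>)) {x \<in> space (PiM {..<n} (\<lambda>_. \<mu>)). \<bar>(\<Sum>i<n. b i * x i) - a\<bar> \<le> \<beta>}
           \<ge> n powr (- B)"
      obtain z where z: "\<bar>z\<bar> \<ge> c1"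
        "measure (PiM {..<n} (\<lambda>_. \<mu>)) {x \<in> space (PiM {..<n} (\<lambda>_. \<mu>)). \<bar>(\<Sum>i<n. b i * x i) - a\<bar> \<le> \<beta>}
         \<le> 4 * (LINT g|std_normal_distribution. (\<Prod>i<n. 1 - l + l * cos (z / \<beta> * b i * g)))"
        using linear_concentration[OF \<mu> assms(5) \<beta> c3 l_def] by blast
      define L where "L = nat \<lceil>n powr (\<epsilon> / 2)\<rceil>"
      have L_ge: "n powr (\<epsilon> / 2) \<le> L" unfolding L_def by (rule real_nat_ceiling_ge)
      have L_le: "L \<le> n powr (\<epsilon> / 2) + 1"
      proof -
        have "0 \<le> \<lceil>n powr (\<epsilon> / 2)\<rceil>" using powr_ge_zero[of "real n" "\<epsilon> / 2"] by linarith
        then have "real L = of_int \<lceil>n powr (\<epsilon> / 2)\<rceil>" by (simp add: L_def)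
        then show ?thesis by linarith
      qed
      have "1 \<le> n powr (\<epsilon> / 2)" using n assms by (intro ge_one_powr_ge_zero) auto
      then have L0: "L > 0" using L_ge by linarith
      have "n powr (\<epsilon> / 2) \<le> n powr 1" using n assms by (intro powr_mono) auto
      then have Ln: "L \<le> n" using n unfolding L_def by (simp add: nat_le_iff ceiling_le_iff)
      interpret concentrated n L b z \<beta> c1 l "n powr (- B) / 4"
        by unfold_locales (use assms z \<beta> l P L0 in auto)
      have p0: "8 * lazy_walk l L 0 \<le> n powr (- e)"
      proof -
        have "8 * lazy_walk l L 0 \<le> 24 / sqrt (l * L)" using lazy_walk_0_le[of l L] l L0 by simp
        also have "\<dots> \<le> 24 / sqrt (l * n powr (\<epsilon> / 2))"
          using l L0 L_ge n by (intro divide_left_mono) auto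
        also have "\<dots> \<le> n powr (- e)" using n by (simp add: e_def)
        finally show ?thesis .
      qed
      obtain I0 and D :: nat where R: "I0 \<subseteq> {..<n}" "card I0 < d" "1 \<le> D" "D \<le> n powr (Q ^ d)"
        "card {i\<in>{..<n} - I0. \<not> integer_related b \<beta> I0 (n powr (Q ^ d)) D i}
          \<le> L * (d + 2 + Q ^ d * log 2 n)"
        using integer_relations[OF _ Ln assms(3) refl _ p0 \<eta> d Q_def] n by auto
      have QC: "n powr (Q ^ d) \<le> n powr C" unfolding C_def using n by (intro powr_mono) auto
      then have \<beta>QC: "\<beta> * n powr (Q ^ d) \<le> \<beta> * n powr C" using \<beta> by simp
      have "card {i\<in>{..<n} - I0. \<not> integer_related b \<beta> I0 (n powr C) D i}
        \<le> card {i\<in>{..<n} - I0. \<not> integer_related b \<beta> I0 (n powr (Q ^ d)) D i}"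
        using integer_related_mono[OF _ QC \<beta>QC] by (intro card_mono) (simp, blast)
      then have "real (card {i\<in>{..<n} - I0. \<not> integer_related b \<beta> I0 (n powr C) D i}) \<le> L * (d + 2 + Q ^ d * log 2 n)"
        using R(5) by linarith
      also have "\<dots> \<le> (n powr (\<epsilon> / 2) + 1) * (d + 2 + Q ^ d * log 2 n)"
        using L_le n Qd by (intro mult_right_mono) auto
      also have "\<dots> \<le> n powr \<epsilon>" using n by simp
      finally have few: "real (card {i\<in>{..<n} - I0. \<not> integer_related b \<beta> I0 (n powr C) D i}) \<le> n powr \<epsilon>" .
      have "card I0 \<le> C" using R(2) Qd unfolding C_def by linarith
      moreover have "D \<le> n powr C" using R(4) QC by linarith
      ultimately show "\<exists>I0 (D::nat). I0 \<subseteq> {..<n} \<and> card I0 \<le> C \<and> 1 \<le> D \<and> D \<le> n powr C \<and>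
         card {i\<in>{..<n} - I0. \<not> integer_related b \<beta> I0 (n powr C) D i} \<le> n powr \<epsilon>"
        by (intro exI[of _ I0] exI[of _ D] conjI R(1,3) few)
    qed
  qed
qed

subsection \<open>From linear to bilinear forms\<close>

lemma (in prob_space) pigeonhole_prob:
  fixes p m :: real
  assumes "finite T" "\<And>t. t \<in> T \<Longrightarrow> E t \<in> events" "S \<subseteq> (\<Union>t\<in>T. E t)"
    and "prob S \<ge> p" "p > 0" "card T \<le> m"
  shows "\<exists>t\<in>T. prob (E t) \<ge> p / m"
proof (rule ccontr)
  assume "\<not> ?thesis"
  then have less: "prob (E t) < p / m" if "t \<in> T" for t using that by force
  have "prob S \<le> prob (\<Union>t\<in>T. E t)"
    using assms by (intro finite_measure_mono sets.finite_UN) auto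
  also have "\<dots> \<le> (\<Sum>t\<in>T. prob (E t))"
    using assms by (intro finite_measure_subadditive_finite) auto
  finally have le: "p \<le> (\<Sum>t\<in>T. prob (E t))" using assms by linarith
  then have "T \<noteq> {}" using assms by auto
  then have "(\<Sum>t\<in>T. prob (E t)) < (\<Sum>t\<in>T. p / m)"
    using less assms by (intro sum_strict_mono) auto
  also have "\<dots> = card T / m * p" by simp
  also have "\<dots> \<le> 1 * p" using assms by (intro mult_right_mono) (auto simp: divide_le_eq_1)
  finally show False using le by simp
qed

text \<open>A set is listed as a word of length exactly \<open>c\<close>, padded with the extra
  letter \<open>n\<close>.\<close>

lemma card_subsets_card_le:
  "finite {I. I \<subseteq> {..<n} \<and> card I \<le> c}" "card {I. I \<subseteq> {..<n} \<and> card I \<le> c} \<le> (n + 1) ^ c"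
proof -
  let ?L = "{xs. set xs \<subseteq> {..n} \<and> length xs = c}"
  have "{I. I \<subseteq> {..<n} \<and> card I \<le> c} \<subseteq> (\<lambda>xs. set xs - {n}) ` ?L"
  proof
    fix I assume I: "I \<in> {I. I \<subseteq> {..<n} \<and> card I \<le> c}"
    then have "finite I" using finite_subset by blast
    then obtain xs where xs: "set xs = I" "distinct xs" using finite_distinct_list by blast
    then have "length xs = card I" by (simp add: distinct_card[symmetric])
    then have "xs @ replicate (c - card I) n \<in> ?L"
      using I xs by (auto dest: in_set_replicate[THEN iffD1])
    moreover have "I = set (xs @ replicate (c - card I) n) - {n}" using xs I by auto
    ultimately show "I \<in> (\<lambda>xs. set xs - {n}) ` ?L" by blast
  qed
  moreover have fin: "finite ?L" by (rule finite_lists_length_eq) simp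
  ultimately have "card {I. I \<subseteq> {..<n} \<and> card I \<le> c} \<le> card ?L"
    and 1: "finite {I. I \<subseteq> {..<n} \<and> card I \<le> c}"
    by (auto intro: surj_card_le finite_subset)
  then show "card {I. I \<subseteq> {..<n} \<and> card I \<le> c} \<le> (n + 1) ^ c"
    by (simp add: card_lists_length_eq)
  show "finite {I. I \<subseteq> {..<n} \<and> card I \<le> c}" by (rule 1)
qed

text \<open>Restricting the coefficients to a finite box makes the relation a finite union of
  events: it is measurable and open to the pigeonhole principle.\<close>

lemma integer_related_iff:
  "integer_related b \<beta> I0 M D i \<longleftrightarrow> (\<exists>k\<in>PiE I0 (\<lambda>_. {-\<lfloor>M\<rfloor>..\<lfloor>M\<rfloor>}).
     \<bar>D * b i + (\<Sum>j\<in>I0. of_int (k j) * b j)\<bar> \<le> \<beta> * M)"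
proof
  assume "integer_related b \<beta> I0 M D i"
  then obtain k :: "nat \<Rightarrow> int" where k: "\<And>j. j \<in> I0 \<Longrightarrow> \<bar>real_of_int (k j)\<bar> \<le> M"
    "\<bar>D * b i + (\<Sum>j\<in>I0. of_int (k j) * b j)\<bar> \<le> \<beta> * M"
    unfolding integer_related_def by blast
  have "restrict k I0 \<in> PiE I0 (\<lambda>_. {-\<lfloor>M\<rfloor>..\<lfloor>M\<rfloor>})"
  proof (rule restrict_PiE_iff[THEN iffD2], rule ballI)
    fix j assume "j \<in> I0"
    then have "of_int (k j) \<le> M" "of_int (- k j) \<le> M" using k(1)[of j] by auto
    then have "k j \<le> \<lfloor>M\<rfloor>" "- k j \<le> \<lfloor>M\<rfloor>" by (simp_all only: le_floor_iff)
    then show "k j \<in> {-\<lfloor>M\<rfloor>..\<lfloor>M\<rfloor>}" by simp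
  qed
  then show "\<exists>k\<in>PiE I0 (\<lambda>_. {-\<lfloor>M\<rfloor>..\<lfloor>M\<rfloor>}).
     \<bar>D * b i + (\<Sum>j\<in>I0. of_int (k j) * b j)\<bar> \<le> \<beta> * M"
    using k(2) by (intro bexI[of _ "restrict k I0"]) simp_all
next
  assume "\<exists>k\<in>PiE I0 (\<lambda>_. {-\<lfloor>M\<rfloor>..\<lfloor>M\<rfloor>}). \<bar>D * b i + (\<Sum>j\<in>I0. of_int (k j) * b j)\<bar> \<le> \<beta> * M"
  then obtain k where k: "k \<in> PiE I0 (\<lambda>_. {-\<lfloor>M\<rfloor>..\<lfloor>M\<rfloor>})"
    "\<bar>D * b i + (\<Sum>j\<in>I0. of_int (k j) * b j)\<bar> \<le> \<beta> * M" by blast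
  have "\<bar>real_of_int (k j)\<bar> \<le> M" if "j \<in> I0" for j
  proof -
    have "k j \<in> {-\<lfloor>M\<rfloor>..\<lfloor>M\<rfloor>}" using k(1) that by (rule PiE_mem)
    then show ?thesis by (simp add: abs_le_iff le_floor_iff) linarith
  qed
  then show "integer_related b \<beta> I0 M D i" unfolding integer_related_def using k(2) by blast
qed

lemma card_coefficient_box:
  fixes C :: real
  assumes "n \<ge> (3::nat)" "C \<ge> 0" "card I0 \<le> C" "finite I0"
  shows "card (PiE I0 (\<lambda>_. {-\<lfloor>n powr C\<rfloor>..\<lfloor>n powr C\<rfloor>})) \<le> n powr ((C + 1) * C)"
proof -
  define M where "M = \<lfloor>n powr C\<rfloor>"
  have "1 \<le> n powr C" using assms by (intro ge_one_powr_ge_zero) auto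
  then have M: "1 \<le> M" "M \<le> n powr C" by (auto simp: M_def)
  have "real (card (PiE I0 (\<lambda>_. {-M..M}))) = real (nat (2 * M + 1)) ^ card I0"
    using assms by (simp add: card_PiE algebra_simps)
  also have "\<dots> \<le> (n powr (C + 1)) ^ card I0"
  proof (intro power_mono)
    have "real (nat (2 * M + 1)) \<le> 3 * n powr C" using M by simp
    also have "\<dots> \<le> n * n powr C" using assms by (intro mult_right_mono) auto
    also have "\<dots> = n powr (C + 1)" using assms by (simp add: powr_add)
    finally show "real (nat (2 * M + 1)) \<le> n powr (C + 1)" .
  qed simp
  also have "\<dots> = n powr ((C + 1) * card I0)" using assms by (simp add: powr_realpow[symmetric] powr_powr)
  also have "\<dots> \<le> n powr ((C + 1) * C)" using assms by (intro powr_mono mult_left_mono) auto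
  finally show ?thesis by (simp add: M_def)
qed

text \<open>Double counting of failures on \<open>E\<close>: their expected number there is at most
  \<open>\<kappa> * prob E\<close>, while an index with \<open>prob (R i) < prob E / 2\<close> fails
  on \<open>E\<close> with probability at least \<open>prob E / 2\<close>.\<close>

lemma (in prob_space) frequent_indices:
  fixes \<kappa> :: real
  assumes J: "finite J" and R [measurable]: "\<And>i. i \<in> J \<Longrightarrow> R i \<in> events"
    and E: "E = {y\<in>space M. card {i\<in>J. y \<notin> R i} \<le> \<kappa>}"
  shows "E \<in> events"
    and "prob E > 0 \<Longrightarrow> card {i\<in>J. prob (R i) < prob E / 2} \<le> 2 * \<kappa>"
proof -
  have card: "real (card {i\<in>J. y \<notin> R i}) = (\<Sum>i\<in>J. indicator (space M - R i) y)" if "y \<in> space M" for y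
    using J that by (simp add: indicator_def sum.If_cases Int_def)
  \<comment> \<open>As a sum of indicators the count is visibly measurable.\<close>
  have E': "E = {y\<in>space M. (\<Sum>i\<in>J. indicator (space M - R i) y) \<le> \<kappa>}"
    unfolding E using card by auto
  show Ev[measurable]: "E \<in> events" unfolding E' by measurable
  assume pos: "prob E > 0"
  let ?B = "{i\<in>J. prob (R i) < prob E / 2}"
  have int: "integrable M (\<lambda>y. indicator (E - R i) y :: real)" if "i \<in> J" for i
    using that by (intro integrable_const_bound[of _ 1]) auto
  have "card ?B * (prob E / 2) = (\<Sum>i\<in>?B. prob E / 2)" by simp
  also have "\<dots> \<le> (\<Sum>i\<in>?B. prob (E - R i))"
  proof (rule sum_mono)
    fix i assume i: "i \<in> ?B"
    then have "prob E \<le> prob (E - R i) + prob (R i)"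
      using measure_Un_le[of "E - R i" M "R i"] finite_measure_mono[of E "(E - R i) \<union> R i"] R[of i] Ev
      by force
    then show "prob E / 2 \<le> prob (E - R i)" using i by simp
  qed
  also have "\<dots> \<le> (\<Sum>i\<in>J. prob (E - R i))" using J by (intro sum_mono2) auto
  also have "\<dots> = (\<Sum>i\<in>J. expectation (indicator (E - R i)))"
    using R by (intro sum.cong) (auto simp: Int_absorb2 sets.sets_into_space)
  also have "\<dots> = expectation (\<lambda>y. \<Sum>i\<in>J. indicator (E - R i) y)"
    using int by (subst Bochner_Integration.integral_sum) auto
  also have "\<dots> \<le> expectation (\<lambda>y. \<kappa> * indicator E y)"
  proof (intro integral_mono Bochner_Integration.integrable_sum int)
    fix y assume y: "y \<in> space M"
    have "(\<Sum>i\<in>J. indicator (E - R i) y) = indicator E y * (\<Sum>i\<in>J. indicator (space M - R i) y :: real)"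
      using y by (auto simp: indicator_def sum_distrib_left intro!: sum.cong)
    also have "\<dots> \<le> indicator E y * \<kappa>"
      using y unfolding E' by (auto simp: indicator_def)
    finally show "(\<Sum>i\<in>J. indicator (E - R i) y) \<le> \<kappa> * indicator E y" by (simp add: mult.commute)
  next
    show "integrable M (\<lambda>y. \<kappa> * indicator E y)"
      by (intro integrable_mult_right integrable_const_bound[of _ 1]) auto
  qed
  also have "\<dots> = \<kappa> * prob E" using Ev by (simp add: Int_absorb2 sets.sets_into_space)
  finally show "card ?B \<le> 2 * \<kappa>" using pos by (simp add: field_simps)
qed

text \<open>The pigeonhole principle is used first for the pair of \<open>I0\<close> and
  \<open>D\<close>, where \<open>2 * C\<close> of the exponent counts sets and \<open>C\<close>
  counts multipliers. After \<open>frequent_indices\<close> it is used in each row separately, so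
  only the coefficient vectors of one row are counted. The loss of \<open>C\<close> in the size of
  \<open>I\<close> comes from removing \<open>I0\<close>.\<close>

lemma (in prob_space) common_integer_relations:
  fixes bb :: "'a \<Rightarrow> nat \<Rightarrow> real" and C \<beta> \<epsilon> p :: real
  assumes meas [measurable]: "\<And>i. (\<lambda>y. bb y i) \<in> borel_measurable M"
    and S: "prob S \<ge> p" "S \<subseteq> space M" "p > 0" and n: "n \<ge> 3" and C: "C \<ge> 0"
    and rel: "\<And>y. y \<in> S \<Longrightarrow> \<exists>I0 (D::nat). I0 \<subseteq> {..<n} \<and> card I0 \<le> C \<and> 1 \<le> D \<and> D \<le> n powr C \<and>
       card {i\<in>{..<n} - I0. \<not> integer_related (bb y) \<beta> I0 (n powr C) D i} \<le> n powr \<epsilon>"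
  shows "\<exists>I0 (D::nat) I (k::nat \<Rightarrow> nat \<Rightarrow> int). I0 \<subseteq> {..<n} \<and> card I0 \<le> C \<and> 1 \<le> D \<and> D \<le> n powr C \<and>
     I \<subseteq> {..<n} - I0 \<and> n - C - 2 * n powr \<epsilon> \<le> card I \<and> (\<forall>i\<in>I. \<forall>j\<in>I0. \<bar>real_of_int (k i j)\<bar> \<le> n powr C) \<and>
     (\<forall>i\<in>I. prob {y\<in>space M. \<bar>D * bb y i + (\<Sum>j\<in>I0. of_int (k i j) * bb y j)\<bar> \<le> \<beta> * n powr C}
        \<ge> p / 2 * n powr (- (3 * C + (C + 1) * C)))"
proof -
  let ?N = "n powr C"
  define c where "c = nat \<lfloor>C\<rfloor>"
  have c: "c \<le> C" using C by (simp add: c_def)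
  have cC: "card I0 \<le> C \<longleftrightarrow> card I0 \<le> c" for I0 :: "nat set"
    using C by (simp add: c_def le_nat_iff le_floor_iff)
  define R where "R I0 D i = {y\<in>space M. integer_related (bb y) \<beta> I0 ?N D i}" for I0 D i
  define E where "E t = {y\<in>space M. card {i\<in>{..<n} - fst t. y \<notin> R (fst t) (snd t) i} \<le> n powr \<epsilon>}" for t
  define T where "T = {I0. I0 \<subseteq> {..<n} \<and> card I0 \<le> c} \<times> {1..nat \<lfloor>?N\<rfloor>}"
  have Rev: "R I0 D i \<in> events" if "I0 \<subseteq> {..<n}" for I0 D i
  proof -
    have "finite I0" using that finite_subset by blast
    then have fin: "finite (PiE I0 (\<lambda>_. {-\<lfloor>?N\<rfloor>..\<lfloor>?N\<rfloor>}))" by (intro finite_PiE) auto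
    have "R I0 D i = (\<Union>k\<in>PiE I0 (\<lambda>_. {-\<lfloor>?N\<rfloor>..\<lfloor>?N\<rfloor>}).
       {y\<in>space M. \<bar>D * bb y i + (\<Sum>j\<in>I0. of_int (k j) * bb y j)\<bar> \<le> \<beta> * ?N})"
      unfolding R_def integer_related_iff by blast
    also have "\<dots> \<in> events" by (intro sets.finite_UN fin) measurable
    finally show ?thesis .
  qed
  have finT: "finite T" unfolding T_def using card_subsets_card_le(1) by simp
  have cardT: "card T \<le> n powr (3 * C)"
  proof -
    have "real (card T) = real (card {I0. I0 \<subseteq> {..<n} \<and> card I0 \<le> c}) * real (nat \<lfloor>?N\<rfloor>)"
      unfolding T_def card_cartesian_product of_nat_mult by simp
    also have "\<dots> \<le> real ((n + 1) ^ c) * ?N"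
      by (rule mult_mono[OF of_nat_mono[OF card_subsets_card_le(2)]]) simp_all
    also have "\<dots> \<le> (real n ^ 2) ^ c * ?N"
      unfolding of_nat_power
    proof (rule mult_right_mono, rule power_mono)
      have "real n * 3 \<le> real n * real n" using n by (intro mult_left_mono) auto
      then show "real (n + 1) \<le> (real n)\<^sup>2" unfolding power2_eq_square using n by linarith
    qed simp_all
    also have "(real n ^ 2) ^ c = n powr (2 * c)"
      using powr_realpow[of "real n" "2 * c"] n by (simp add: power_mult)
    also have "n powr (2 * c) * ?N \<le> n powr (2 * C) * ?N"
      using n c by (intro mult_right_mono powr_mono) auto
    finally show ?thesis by (simp add: powr_add[symmetric])
  qed
  have Eev: "E t \<in> events" if "t \<in> T" for t
    unfolding E_def using that Rev by (intro frequent_indices(1)[OF _ _ refl]) (auto simp: T_def)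
  have "S \<subseteq> (\<Union>t\<in>T. E t)"
  proof
    fix y assume y: "y \<in> S"
    then obtain I0 and D :: nat where h: "I0 \<subseteq> {..<n}" "card I0 \<le> C" "1 \<le> D" "D \<le> ?N"
       "card {i\<in>{..<n} - I0. \<not> integer_related (bb y) \<beta> I0 ?N D i} \<le> n powr \<epsilon>"
      using rel[OF y] by blast
    have "D \<le> nat \<lfloor>?N\<rfloor>" using h(4) by (simp add: le_nat_iff le_floor_iff)
    then have "(I0, D) \<in> T" unfolding T_def using h cC by auto
    moreover have "y \<in> E (I0, D)" unfolding E_def R_def using y S(2) h(5) by (auto simp: subset_iff)
    ultimately show "y \<in> (\<Union>t\<in>T. E t)" by blast
  qed
  then obtain t where t: "t \<in> T" "p / n powr (3 * C) \<le> prob (E t)"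
    using pigeonhole_prob[of T E S p "n powr (3 * C)"] finT Eev S(1,3) cardT by blast
  obtain I0 D where tt: "t = (I0, D)" by (cases t)
  have I0: "I0 \<subseteq> {..<n}" "card I0 \<le> C" and D: "1 \<le> D" "D \<le> ?N"
    using t(1) cC unfolding tt T_def by (auto simp: le_nat_iff le_floor_iff)
  have finI0: "finite I0" using I0 finite_subset by blast
  have q: "p / n powr (3 * C) > 0" using S n by simp
  let ?J = "{..<n} - I0"
  define I where "I = {i\<in>?J. \<not> prob (R I0 D i) < prob (E t) / 2}"
  have "card {i\<in>?J. prob (R I0 D i) < prob (E t) / 2} \<le> 2 * n powr \<epsilon>"
    using t q I0(1) Rev by (intro frequent_indices(2)[of ?J "R I0 D" "E t"]) (auto simp: E_def tt)
  moreover have "card ?J = card I + card {i\<in>?J. prob (R I0 D i) < prob (E t) / 2}"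
    unfolding I_def by (subst card_Un_disjoint[symmetric]) (auto intro!: arg_cong[where f = card])
  moreover have "real (card ?J) = n - card I0"
    using I0 finI0 card_mono[OF _ I0(1)] by (simp add: card_Diff_subset)
  ultimately have cardI: "n - C - 2 * n powr \<epsilon> \<le> card I" using I0(2) by linarith
  have "\<forall>i\<in>I. \<exists>k\<in>PiE I0 (\<lambda>_. {-\<lfloor>?N\<rfloor>..\<lfloor>?N\<rfloor>}).
     prob {y\<in>space M. \<bar>D * bb y i + (\<Sum>j\<in>I0. of_int (k j) * bb y j)\<bar> \<le> \<beta> * ?N}
        \<ge> (p / n powr (3 * C) / 2) / n powr ((C + 1) * C)"
  proof
    fix i assume i: "i \<in> I"
    show "\<exists>k\<in>PiE I0 (\<lambda>_. {-\<lfloor>?N\<rfloor>..\<lfloor>?N\<rfloor>}).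
     prob {y\<in>space M. \<bar>D * bb y i + (\<Sum>j\<in>I0. of_int (k j) * bb y j)\<bar> \<le> \<beta> * ?N}
        \<ge> (p / n powr (3 * C) / 2) / n powr ((C + 1) * C)"
    proof (rule pigeonhole_prob[where S = "R I0 D i"])
      show "finite (PiE I0 (\<lambda>_. {-\<lfloor>?N\<rfloor>..\<lfloor>?N\<rfloor>}))" using finI0 by (intro finite_PiE) auto
      show "R I0 D i \<subseteq> (\<Union>k\<in>PiE I0 (\<lambda>_. {-\<lfloor>?N\<rfloor>..\<lfloor>?N\<rfloor>}).
        {y\<in>space M. \<bar>D * bb y i + (\<Sum>j\<in>I0. of_int (k j) * bb y j)\<bar> \<le> \<beta> * ?N})"
        unfolding R_def integer_related_iff by blast
      show "p / n powr (3 * C) / 2 \<le> prob (R I0 D i)" using i t unfolding I_def by simp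
      show "0 < p / n powr (3 * C) / 2" using q by simp
      show "card (PiE I0 (\<lambda>_. {-\<lfloor>?N\<rfloor>..\<lfloor>?N\<rfloor>})) \<le> n powr ((C + 1) * C)"
        using card_coefficient_box[OF n C I0(2) finI0] .
    qed measurable
  qed
  then have "\<exists>k. \<forall>i\<in>I. k i \<in> PiE I0 (\<lambda>_. {-\<lfloor>?N\<rfloor>..\<lfloor>?N\<rfloor>}) \<and>
     prob {y\<in>space M. \<bar>D * bb y i + (\<Sum>j\<in>I0. of_int (k i j) * bb y j)\<bar> \<le> \<beta> * ?N}
        \<ge> (p / n powr (3 * C) / 2) / n powr ((C + 1) * C)"
    unfolding Bex_def by (rule bchoice)
  then obtain k where k: "\<And>i. i \<in> I \<Longrightarrow> k i \<in> PiE I0 (\<lambda>_. {-\<lfloor>?N\<rfloor>..\<lfloor>?N\<rfloor>})"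
     "\<And>i. i \<in> I \<Longrightarrow> prob {y\<in>space M. \<bar>D * bb y i + (\<Sum>j\<in>I0. of_int (k i j) * bb y j)\<bar> \<le> \<beta> * ?N}
        \<ge> (p / n powr (3 * C) / 2) / n powr ((C + 1) * C)"
    by blast
  have kN: "\<bar>real_of_int (k i j)\<bar> \<le> ?N" if "i \<in> I" "j \<in> I0" for i j
  proof -
    have "k i j \<in> {-\<lfloor>?N\<rfloor>..\<lfloor>?N\<rfloor>}" using k(1)[OF that(1)] that(2) by (rule PiE_mem)
    then show ?thesis by (simp add: abs_le_iff le_floor_iff) linarith
  qed
  have "p / n powr (3 * C) / 2 / n powr ((C + 1) * C) = p / 2 * n powr (- (3 * C + (C + 1) * C))"
    unfolding powr_minus_divide powr_add by simp
  then have kP: "prob {y\<in>space M. \<bar>D * bb y i + (\<Sum>j\<in>I0. of_int (k i j) * bb y j)\<bar> \<le> \<beta> * ?N}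
        \<ge> p / 2 * n powr (- (3 * C + (C + 1) * C))" if "i \<in> I" for i
    using k(2)[OF that] by simp
  have IJ: "I \<subseteq> {..<n} - I0" unfolding I_def by blast
  show ?thesis
    by (intro exI[of _ I0] exI[of _ D] exI[of _ I] exI[of _ k] conjI ballI I0 D IJ cardI kN kP)
qed

section \<open>Slicing the joint concentration event\<close>

lemma (in prob_space) prob_ge_of_expectation:
  assumes g [measurable]: "g \<in> borel_measurable M" and g01: "\<And>y. 0 \<le> g y" "\<And>y. g y \<le> 1"
    and t: "expectation g \<ge> 2 * t" "t \<ge> 0"
  shows "prob {y\<in>space M. g y \<ge> t} \<ge> t"
proof -
  let ?S = "{y\<in>space M. g y \<ge> t}"
  have "expectation g \<le> expectation (\<lambda>y. indicator ?S y + t)"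
  proof (intro integral_mono)
    show "integrable M g" using g01 by (intro integrable_const_bound[of _ 1]) auto
    show "integrable M (\<lambda>y. indicator ?S y + t)"
      by (intro Bochner_Integration.integrable_add integrable_const_bound[of "indicator ?S" 1]) auto
    fix y assume "y \<in> space M"
    then show "g y \<le> indicator ?S y + t" using g01[of y] t by (auto simp: indicator_def)
  qed
  also have "\<dots> = prob ?S + t"
    by (subst Bochner_Integration.integral_add) (auto intro: integrable_const_bound[of _ 1] simp: prob_space Int_absorb2)
  finally show ?thesis using t by simp
qed

text \<open>By Fubini the probability of the section at \<open>y\<close> has mean at least
  \<open>2 * t\<close>; being at most 1, it reaches \<open>t\<close> with probability at least
  \<open>t\<close>.\<close>

lemma (in pair_prob_space) prob_pair_sections:
  assumes E [measurable]: "E \<in> sets (M1 \<Otimes>\<^sub>M M2)" and p: "measure (M1 \<Otimes>\<^sub>M M2) E \<ge> 2 * t" "t \<ge> 0"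
  shows "M2.prob {y\<in>space M2. M1.prob {x\<in>space M1. (x, y) \<in> E} \<ge> t} \<ge> t"
    and "{y\<in>space M2. M1.prob {x\<in>space M1. (x, y) \<in> E} \<ge> t} \<in> M2.events"
proof -
  have sec: "M1.prob {x\<in>space M1. (x, y) \<in> E} = (LINT x|M1. indicator E (x, y))" if "y \<in> space M2" for y
  proof -
    have "(LINT x|M1. indicator E (x, y) :: real) = (LINT x|M1. indicator {x\<in>space M1. (x, y) \<in> E} x)"
      by (intro Bochner_Integration.integral_cong) (auto simp: indicator_def)
    also have "\<dots> = M1.prob {x\<in>space M1. (x, y) \<in> E}" by (simp add: Int_absorb2)
    finally show ?thesis by simp
  qed
  have int: "integrable (M1 \<Otimes>\<^sub>M M2) (\<lambda>(x, y). indicator E (x, y) :: real)"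
    by (intro P.integrable_const_bound[of _ 1]) auto
  define g where "g y = (LINT x|M1. indicator E (x, y) :: real)" for y
  have g [measurable]: "g \<in> borel_measurable M2"
    unfolding g_def by measurable
  have g01: "0 \<le> g y" "g y \<le> 1" for y
  proof -
    show "0 \<le> g y" unfolding g_def by (intro Bochner_Integration.integral_nonneg) auto
    show "g y \<le> 1"
    \<comment> \<open>A function that is not integrable has integral 0 by convention, so the bound
      holds for every \<open>y\<close>, also outside the space.\<close>
    proof (cases "integrable M1 (\<lambda>x. indicator E (x, y) :: real)")
      case True
      then have "g y \<le> (LINT x|M1. 1)" unfolding g_def by (intro integral_mono) (auto simp: indicator_def)
      then show ?thesis by (simp add: M1.prob_space)
    qed (simp add: g_def not_integrable_integral_eq)
  qed
  have "M2.expectation g = measure (M1 \<Otimes>\<^sub>M M2) E"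
    using integral_snd[OF int] sets.sets_into_space[OF E]
    by (simp add: g_def[abs_def] case_prod_unfold Int_absorb2)
  then have "M2.prob {y\<in>space M2. g y \<ge> t} \<ge> t"
    using p by (intro M2.prob_ge_of_expectation g g01) auto
  moreover have eq: "{y\<in>space M2. M1.prob {x\<in>space M1. (x, y) \<in> E} \<ge> t} = {y\<in>space M2. g y \<ge> t}"
    using sec unfolding g_def by auto
  ultimately show "M2.prob {y\<in>space M2. M1.prob {x\<in>space M1. (x, y) \<in> E} \<ge> t} \<ge> t" by simp
  show "{y\<in>space M2. M1.prob {x\<in>space M1. (x, y) \<in> E} \<ge> t} \<in> M2.events"
    unfolding eq by measurable
qed

text \<open>As \<open>i\<close> is not in \<open>I0\<close>, the diagonal entry \<open>k\<close>
  overrides no coefficient \<open>K i t\<close>, and the row of the product is the full integer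
  combination of rows of \<open>A\<close>.\<close>

lemma row_operation_scalar_prod:
  assumes A: "A \<in> carrier_mat n n" and I0: "I0 \<subseteq> {..<n}" and i: "i \<in> I" "i < n" "i \<notin> I0"
  shows "scalar_prod (Matrix.vec n w) (Matrix.row (row_operation n I0 I k K * A) i)
     = k * (\<Sum>j<n. A $$ (i, j) * w j) + (\<Sum>t\<in>I0. K i t * (\<Sum>j<n. A $$ (t, j) * w j))"
proof -
  let ?R = "row_operation n I0 I k K"
  let ?b = "\<lambda>t. \<Sum>j<n. A $$ (t, j) * w j"
  have R: "?R \<in> carrier_mat n n" by (simp add: row_operation_def)
  have "scalar_prod (Matrix.vec n w) (Matrix.row (?R * A) i) = (\<Sum>j<n. w j * (?R * A) $$ (i, j))"
    using A R i by (simp add: scalar_prod_def lessThan_atLeast0)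
  also have "\<dots> = (\<Sum>j<n. w j * (\<Sum>t<n. ?R $$ (i, t) * A $$ (t, j)))"
    using A R i by (intro sum.cong) (auto simp: scalar_prod_def lessThan_atLeast0)
  also have "\<dots> = (\<Sum>t<n. ?R $$ (i, t) * ?b t)"
    by (simp add: sum_distrib_left) (subst sum.swap, simp add: mult_ac)
  also have "\<dots> = (\<Sum>t\<in>insert i I0. ?R $$ (i, t) * ?b t)"
    using I0 i by (intro sum.mono_neutral_right) (auto simp: row_operation_def)
  also have "\<dots> = ?R $$ (i, i) * ?b i + (\<Sum>t\<in>I0. ?R $$ (i, t) * ?b t)"
    using I0 i by (subst sum.insert) (auto intro: finite_subset)
  also have "?R $$ (i, i) = k" using i by (simp add: row_operation_def)
  also have "(\<Sum>t\<in>I0. ?R $$ (i, t) * ?b t) = (\<Sum>t\<in>I0. K i t * ?b t)"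
  proof (intro sum.cong refl)
    fix t assume "t \<in> I0"
    then have "t < n" "t \<noteq> i" using I0 i by auto
    then show "?R $$ (i, t) * ?b t = K i t * ?b t"
      using i \<open>t \<in> I0\<close> by (simp add: row_operation_def)
  qed
  finally show ?thesis .
qed

theorem theorem3p2:
  fixes \<epsilon> B c1 c2 c3 :: real
  assumes "0 < \<epsilon>" "\<epsilon> < 1" "0 < B" "0 < c1" "c1 < c2" "0 < c3"
  shows "\<exists>(C::real) (N::nat). \<forall>n\<ge>N. \<forall>(\<mu>::real measure) (\<beta>::real) (A::real mat) (f::nat \<Rightarrow> real).
    \<beta> > 0 \<longrightarrow>
    admissible_law c1 c2 c3 \<mu> \<longrightarrow>
    A \<in> carrier_mat n n \<longrightarrow>
    (\<Sum>i<n. \<Sum>j<n. (A $$ (i, j))\<^sup>2) = 1 \<longrightarrow>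
    bilinear_concentration \<mu> n A f \<beta> \<ge> real n powr (- B) \<longrightarrow>
    (\<exists>(I0::nat set) (I::nat set) (k::int) (K::nat \<Rightarrow> nat \<Rightarrow> int).
       I0 \<subseteq> {..<n} \<and> real (card I0) \<le> C \<and>
       I \<subseteq> {..<n} \<and> real (card I) \<ge> real n - 2 * real n powr \<epsilon> \<and>
       k \<noteq> 0 \<and> \<bar>real_of_int k\<bar> \<le> real n powr C \<and>
       (\<forall>i\<in>I. \<forall>i0\<in>I0. \<bar>real_of_int (K i i0)\<bar> \<le> real n powr C) \<and>
       (\<forall>i\<in>I. \<P>(y in iid_vector \<mu> n.
            \<bar>scalar_prod (Matrix.vec n (\<lambda>j. y j + f j)) (Matrix.row (row_operation n I0 I k K * A) i)\<bar>
              \<le> \<beta> * real n powr C)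
          \<ge> real n powr (- C)))"
proof -
  \<comment> \<open>With a smaller exponent, \<open>C + 2 * n powr \<epsilon>'\<close> stays below
    \<open>2 * n powr \<epsilon>\<close>, which absorbs the removal of \<open>I0\<close> from
    \<open>I\<close>.\<close>
  define \<epsilon>' where "\<epsilon>' = \<epsilon> / 2"
  have \<epsilon>': "0 < \<epsilon>'" "\<epsilon>' < 1" using assms by (auto simp: \<epsilon>'_def)
  obtain C :: real where C: "C \<ge> 0" and linear: "\<forall>\<^sub>F n in sequentially. \<forall>\<mu> \<beta> a (b::nat \<Rightarrow> real).
    \<beta> > 0 \<longrightarrow> real_distribution \<mu> \<longrightarrow>
    measure (\<mu> \<Otimes>\<^sub>M \<mu>) {p \<in> space (\<mu> \<Otimes>\<^sub>M \<mu>). c1 \<le> \<bar>fst p - snd p\<bar> \<and> \<bar>fst p - snd p\<bar> \<le> c2} \<ge> c3 \<longrightarrow>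
    measure (PiM {..<n} (\<lambda>_. \<mu>)) {x \<in> space (PiM {..<n} (\<lambda>_. \<mu>)). \<bar>(\<Sum>i<n. b i * x i) - a\<bar> \<le> \<beta>}
       \<ge> n powr (- (B + 1)) \<longrightarrow>
    (\<exists>I0 (D::nat). I0 \<subseteq> {..<n} \<and> card I0 \<le> C \<and> 1 \<le> D \<and> D \<le> n powr C \<and>
       card {i\<in>{..<n} - I0. \<not> integer_related b \<beta> I0 (n powr C) D i} \<le> n powr \<epsilon>')"
    using linear_inverse_littlewood_offord[OF \<epsilon>' _ assms(4,6), of "B + 1" c2] assms(3) by auto
  \<comment> \<open>Covers the section bound \<open>n powr (- (B + 1))\<close> and the pigeonhole
    loss \<open>3 * C + (C + 1) * C\<close>, and is at least \<open>C\<close>.\<close>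
  define C' where "C' = B + 1 + (4 * C + (C + 1) * C)"
  have "0 \<le> (C + 1) * C" using C by simp
  then have CC': "C \<le> C'" using C assms(3) unfolding C'_def by linarith
  have "((\<lambda>n::real. (C + 2 * n powr (\<epsilon> / 2)) / n powr \<epsilon>) \<longlongrightarrow> 0) at_top"
    using assms by real_asymp
  then have "\<forall>\<^sub>F n::nat in sequentially. (C + 2 * n powr \<epsilon>') / n powr \<epsilon> < 2"
    unfolding \<epsilon>'_def
    by (intro order_tendstoD filterlim_compose[OF _ filterlim_real_sequentially])
       (auto intro: filterlim_compose[OF _ filterlim_real_sequentially])
  with linear have "\<forall>\<^sub>F n in sequentially. \<forall>(\<mu>::real measure) (\<beta>::real) (A::real mat) (f::nat \<Rightarrow> real).
    \<beta> > 0 \<longrightarrow>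
    admissible_law c1 c2 c3 \<mu> \<longrightarrow>
    A \<in> carrier_mat n n \<longrightarrow>
    (\<Sum>i<n. \<Sum>j<n. (A $$ (i, j))\<^sup>2) = 1 \<longrightarrow>
    bilinear_concentration \<mu> n A f \<beta> \<ge> real n powr (- B) \<longrightarrow>
    (\<exists>(I0::nat set) (I::nat set) (k::int) (K::nat \<Rightarrow> nat \<Rightarrow> int).
       I0 \<subseteq> {..<n} \<and> real (card I0) \<le> C' \<and>
       I \<subseteq> {..<n} \<and> real (card I) \<ge> real n - 2 * real n powr \<epsilon> \<and>
       k \<noteq> 0 \<and> \<bar>real_of_int k\<bar> \<le> real n powr C' \<and>
       (\<forall>i\<in>I. \<forall>i0\<in>I0. \<bar>real_of_int (K i i0)\<bar> \<le> real n powr C') \<and>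
       (\<forall>i\<in>I. \<P>(y in iid_vector \<mu> n.
            \<bar>scalar_prod (Matrix.vec n (\<lambda>j. y j + f j)) (Matrix.row (row_operation n I0 I k K * A) i)\<bar>
              \<le> \<beta> * real n powr C')
          \<ge> real n powr (- C')))"
    using eventually_ge_at_top[of "8::nat"]
  proof (eventually_elim, intro allI impI)
    fix n :: nat and \<mu> :: "real measure" and \<beta> :: real and A :: "real mat" and f :: "nat \<Rightarrow> real"
    assume linear: "\<forall>\<mu> \<beta> a (b::nat \<Rightarrow> real). \<beta> > 0 \<longrightarrow> real_distribution \<mu> \<longrightarrow>
      measure (\<mu> \<Otimes>\<^sub>M \<mu>) {p \<in> space (\<mu> \<Otimes>\<^sub>M \<mu>). c1 \<le> \<bar>fst p - snd p\<bar> \<and> \<bar>fst p - snd p\<bar> \<le> c2} \<ge> c3 \<longrightarrow>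
      measure (PiM {..<n} (\<lambda>_. \<mu>)) {x \<in> space (PiM {..<n} (\<lambda>_. \<mu>)). \<bar>(\<Sum>i<n. b i * x i) - a\<bar> \<le> \<beta>}
         \<ge> n powr (- (B + 1)) \<longrightarrow>
      (\<exists>I0 (D::nat). I0 \<subseteq> {..<n} \<and> card I0 \<le> C \<and> 1 \<le> D \<and> D \<le> n powr C \<and>
         card {i\<in>{..<n} - I0. \<not> integer_related b \<beta> I0 (n powr C) D i} \<le> n powr \<epsilon>')"
      and n\<epsilon>: "(C + 2 * n powr \<epsilon>') / n powr \<epsilon> < 2" and n: "n \<ge> 8" and \<beta>: "\<beta> > 0"
      and \<mu>: "admissible_law c1 c2 c3 \<mu>" and A: "A \<in> carrier_mat n n"
      and conc: "bilinear_concentration \<mu> n A f \<beta> \<ge> real n powr (- B)"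
    interpret mu: prob_space \<mu> using \<mu> by (simp add: admissible_law_def)
    have sets_\<mu>[measurable_cong]: "sets \<mu> = sets borel" using \<mu> by (simp add: admissible_law_def)
    have law: "real_distribution \<mu>"
      using sets_\<mu> sets_eq_imp_space_eq[OF sets_\<mu>] by unfold_locales auto
    have c3: "measure (\<mu> \<Otimes>\<^sub>M \<mu>) {p \<in> space (\<mu> \<Otimes>\<^sub>M \<mu>). c1 \<le> \<bar>fst p - snd p\<bar> \<and> \<bar>fst p - snd p\<bar> \<le> c2} \<ge> c3"
      using \<mu> by (simp add: admissible_law_def case_prod_unfold)
    let ?X = "PiM {..<n} (\<lambda>_. \<mu>)"
    interpret PP: product_prob_space "\<lambda>_. \<mu>" "{..<n}" ..
    interpret XX: pair_prob_space ?X ?X ..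
    define bb where "bb y i = (\<Sum>j<n. A $$ (i, j) * (y j + f j))" for y i
    have bb [measurable]: "(\<lambda>y. bb y i) \<in> borel_measurable ?X" for i
      unfolding bb_def by measurable
    define E where "E a = {p \<in> space (?X \<Otimes>\<^sub>M ?X).
      \<bar>(\<Sum>i<n. \<Sum>j<n. A $$ (i, j) * (fst p i + f i) * (snd p j + f j)) - a\<bar> \<le> \<beta>}" for a
    have E_events: "E a \<in> sets (?X \<Otimes>\<^sub>M ?X)" for a unfolding E_def by measurable
    have "bdd_above (range (\<lambda>a. measure (?X \<Otimes>\<^sub>M ?X) (E a)))"
      by (intro bdd_aboveI[of _ 1]) auto
    \<comment> \<open>The supremum need not be attained, but half of its lower bound is exceeded at
      some \<open>a\<close>.\<close>
    moreover have "n powr (- B) / 2 < (SUP a. measure (?X \<Otimes>\<^sub>M ?X) (E a))"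
    proof -
      have "n powr (- B) / 2 < n powr (- B)" using n by simp
      also have "\<dots> \<le> (SUP a. measure (?X \<Otimes>\<^sub>M ?X) (E a))"
        using conc by (simp add: bilinear_concentration_def iid_vector_def E_def case_prod_unfold)
      finally show ?thesis .
    qed
    ultimately obtain a where a: "n powr (- B) / 2 < measure (?X \<Otimes>\<^sub>M ?X) (E a)"
      by (subst (asm) less_cSUP_iff) auto
    \<comment> \<open>Half of the previous bound, since passing to sections loses another factor
      2.\<close>
    define t where "t = n powr (- B) / 4"
    have t0: "t > 0" using n by (simp add: t_def)
    define S where "S = {y\<in>space ?X. measure ?X {x\<in>space ?X. (x, y) \<in> E a} \<ge> t}"
    have S: "measure ?X S \<ge> t"
      unfolding S_def using XX.prob_pair_sections(1)[OF E_events, of t a] a t0 by (simp add: t_def)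
    \<comment> \<open>One more power of \<open>n\<close> absorbs the constants, which is why the
      linear theorem was invoked with \<open>B + 1\<close>.\<close>
    have t_ge: "n powr (- (B + 1)) \<le> t / 2"
    proof -
      have "n powr (- (B + 1)) = n powr (- B) / n" using powr_diff[of n "- B" 1] n by simp
      also have "\<dots> \<le> n powr (- B) / 8" using n by (intro divide_left_mono) auto
      finally show ?thesis by (simp add: t_def)
    qed
    have rel: "\<exists>I0 (D::nat). I0 \<subseteq> {..<n} \<and> card I0 \<le> C \<and> 1 \<le> D \<and> D \<le> n powr C \<and>
       card {i\<in>{..<n} - I0. \<not> integer_related (bb y) \<beta> I0 (n powr C) D i} \<le> n powr \<epsilon>'"
      if y: "y \<in> S" for y
    proof -
      \<comment> \<open>For fixed \<open>y\<close> the form is linear in \<open>x\<close>, and the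
        shift of \<open>x\<close> by \<open>f\<close> only moves the centre.\<close>
      have "{x\<in>space ?X. (x, y) \<in> E a}
          = {x \<in> space ?X. \<bar>(\<Sum>i<n. bb y i * x i) - (a - (\<Sum>i<n. bb y i * f i))\<bar> \<le> \<beta>}"
      proof -
        have "(\<Sum>i<n. \<Sum>j<n. A $$ (i, j) * (x i + f i) * (y j + f j)) - a
            = (\<Sum>i<n. bb y i * x i) - (a - (\<Sum>i<n. bb y i * f i))" for x
        proof -
          have "(\<Sum>i<n. \<Sum>j<n. A $$ (i, j) * (x i + f i) * (y j + f j)) = (\<Sum>i<n. bb y i * (x i + f i))"
            unfolding bb_def sum_distrib_right by (intro sum.cong refl) (simp only: mult_ac)
          then show ?thesis by (simp add: distrib_left sum.distrib)
        qed
        then show ?thesis using y unfolding E_def S_def by (auto simp: space_pair_measure)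
      qed
      then have "measure ?X {x \<in> space ?X. \<bar>(\<Sum>i<n. bb y i * x i) - (a - (\<Sum>i<n. bb y i * f i))\<bar> \<le> \<beta>}
          \<ge> n powr (- (B + 1))"
        using y t_ge t0 unfolding S_def by simp
      then show ?thesis using linear \<beta> law c3 by blast
    qed
    have "n \<ge> 3" using n by simp
    have "S \<subseteq> space ?X" unfolding S_def by blast
    obtain I0 and D :: nat and I and k :: "nat \<Rightarrow> nat \<Rightarrow> int" where
      I0: "I0 \<subseteq> {..<n}" "card I0 \<le> C" and D: "1 \<le> D" "D \<le> n powr C"
      and I: "I \<subseteq> {..<n} - I0" "n - C - 2 * n powr \<epsilon>' \<le> card I"
      and k: "\<forall>i\<in>I. \<forall>j\<in>I0. \<bar>real_of_int (k i j)\<bar> \<le> n powr C"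
      and P: "\<forall>i\<in>I. measure ?X {y\<in>space ?X. \<bar>D * bb y i + (\<Sum>j\<in>I0. of_int (k i j) * bb y j)\<bar> \<le> \<beta> * n powr C}
        \<ge> t / 2 * n powr (- (3 * C + (C + 1) * C))"
      using PP.common_integer_relations[OF bb S \<open>S \<subseteq> space ?X\<close> t0 \<open>n \<ge> 3\<close> C rel] by blast
    have le: "n powr C \<le> n powr C'" using CC' n by (intro powr_mono) auto
    have card_I: "n - 2 * n powr \<epsilon> \<le> card I"
      using I(2) n\<epsilon> n by (simp add: divide_less_eq)
    have prob: "\<P>(y in iid_vector \<mu> n.
        \<bar>scalar_prod (Matrix.vec n (\<lambda>j. y j + f j)) (Matrix.row (row_operation n I0 I (int D) k * A) i)\<bar>
          \<le> \<beta> * real n powr C') \<ge> real n powr (- C')" if i: "i \<in> I" for i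
    proof -
      have i': "i < n" "i \<notin> I0" using i I(1) by auto
      have sp: "scalar_prod (Matrix.vec n (\<lambda>j. y j + f j)) (Matrix.row (row_operation n I0 I (int D) k * A) i)
          = D * bb y i + (\<Sum>j\<in>I0. of_int (k i j) * bb y j)" for y
        using row_operation_scalar_prod[OF A I0(1) i i'] by (simp add: bb_def)
      have "real n powr (- C') \<le> n powr (- (B + 1)) * n powr (- (3 * C + (C + 1) * C))"
        unfolding powr_add[symmetric] C'_def using n C by (intro powr_mono) auto
      also have "\<dots> \<le> t / 2 * n powr (- (3 * C + (C + 1) * C))"
        using t_ge by (intro mult_right_mono) auto
      also have "\<dots> \<le> measure ?X {y\<in>space ?X. \<bar>D * bb y i + (\<Sum>j\<in>I0. of_int (k i j) * bb y j)\<bar> \<le> \<beta> * n powr C}"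
        using P i by blast
      also have "\<dots> \<le> measure ?X {y\<in>space ?X. \<bar>D * bb y i + (\<Sum>j\<in>I0. of_int (k i j) * bb y j)\<bar> \<le> \<beta> * n powr C'}"
      proof (rule PP.finite_measure_mono)
        have "\<beta> * n powr C \<le> \<beta> * n powr C'" using le \<beta> by simp
        then show "{y\<in>space ?X. \<bar>D * bb y i + (\<Sum>j\<in>I0. of_int (k i j) * bb y j)\<bar> \<le> \<beta> * n powr C}
          \<subseteq> {y\<in>space ?X. \<bar>D * bb y i + (\<Sum>j\<in>I0. of_int (k i j) * bb y j)\<bar> \<le> \<beta> * n powr C'}"
          by (auto intro: order_trans)
      qed measurable
      finally show ?thesis unfolding sp iid_vector_def .
    qed
    show "\<exists>(I0::nat set) (I::nat set) (k::int) (K::nat \<Rightarrow> nat \<Rightarrow> int).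
       I0 \<subseteq> {..<n} \<and> real (card I0) \<le> C' \<and>
       I \<subseteq> {..<n} \<and> real (card I) \<ge> real n - 2 * real n powr \<epsilon> \<and>
       k \<noteq> 0 \<and> \<bar>real_of_int k\<bar> \<le> real n powr C' \<and>
       (\<forall>i\<in>I. \<forall>i0\<in>I0. \<bar>real_of_int (K i i0)\<bar> \<le> real n powr C') \<and>
       (\<forall>i\<in>I. \<P>(y in iid_vector \<mu> n.
            \<bar>scalar_prod (Matrix.vec n (\<lambda>j. y j + f j)) (Matrix.row (row_operation n I0 I k K * A) i)\<bar>
              \<le> \<beta> * real n powr C')
          \<ge> real n powr (- C'))"
    proof (rule exI[of _ I0], rule exI[of _ I], rule exI[of _ "int D"], rule exI[of _ k], intro conjI ballI)
      show "card I0 \<le> C'" using I0(2) CC' by linarith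
      show "\<bar>real_of_int (int D)\<bar> \<le> n powr C'" using D(2) le by simp
      show "\<bar>real_of_int (k i j)\<bar> \<le> n powr C'" if "i \<in> I" "j \<in> I0" for i j
        using k that le by (meson order_trans)
    qed (use I0 I D card_I prob in auto)
  qed
  then show ?thesis unfolding eventually_sequentially by (intro exI[of _ C'])
qed

end
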